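(* If $X$ is a metrizable space, then the topological space $(Q_\tau^+(X),\tau_s(G))$ is metrizable.
   Context: $\mathbf F$ is $\mathbf R$ or $\mathbf C$. $C(X,\mathbf F)$ (respectively $C_b(X,\mathbf F)$) is the space of all continuous (respectively bounded continuous) functions from $X$ into $\mathbf F$. $\mathcal F=\mathcal F(X)$ and $\mathcal B=\mathcal B(X)$ are, respectively, the minimal algebra and the minimal $\sigma$-algebra of subsets of $X$ containing all zero sets $f^{-1}(0)$, $f\in C_b(X,\mathbf R)$, and their complements. $G$ is a group (neutral element $e$) acting on $X$ by mappings $h_g:X\to X$ with $h_g\circ h_j=h_{gj}$ for all $g,j\in G$ and $h_e=\mathrm{id}$; $gx:=h_g(x)$. Standing assumption: each $g\in G$ maps $\mathcal F$ into $\mathcal F$ and $gX=X$. $M(X)$ is the family of all measures $m:\mathcal F\to\mathbf F$; $|m|$ is the variation of $m$, and $m^g(A):=m(g^{-1}A)$ for $A\in\mathcal F$. Measures $m,n$ are equivalent if $|m|$ is absolutely continuous relative to $|n|$ and $|n|$ is absolutely continuous relative to $|m|$. A measure $m$ is quasi-invariant relative to $G$ if $m^g$ is equivalent to $m$ for each $g\in G$. A subset $V\subset C(X,\mathbf R)$ is bounded if there are $f,h\in C(X,\mathbf R)$ with $f\le u\le h$ for each $u\in V$. A linear functional $p:C(X,\mathbf R)\to\mathbf R$ is bounded if $p(V)$ is bounded in $\mathbf R$ for each bounded $V\subset C(X,\mathbf R)$. A bounded linear functional $p$ is $\tau$-smooth if $\lim_n p(f_n)=0$ for each net $(f_n:n\in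 A)$ in $C(X,\mathbf R)$, $A$ a directed set, with $f_n\downarrow 0$ (that is, $f_n(x)\ge f_m(x)\ge 0$ for each $m\ge n$ in $A$ and $\lim_n f_n(x)=0$ for each $x\in X$). The measures on $\mathcal B$ corresponding to such functionals, via $p(f)=\int_X f(x)\,m(dx)$, are called $\tau$-smooth. $Q_\tau^+(X)$ is the family of all non-negative $\tau$-smooth measures that are quasi-invariant relative to $G$. $\tau_s(G)$ is the topology induced by the neighborhoods $\{m\in M(X):\ \sup_{g\in G}|\int_X f_r(x)(m^g(dx)-m_0^g(dx))|<y\ \text{for all } r=1,\dots,n\}$ of $m_0$, where $f_1,\dots,f_n\in C_b(X,\mathbf F)$, $n\in\mathbf N$, $y>0$, restricted to $Q_\tau^+(X)$. *)

theory Defs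
  imports "HOL-Analysis.Analysis" "HOL-Algebra.Group_Action"
begin

text \<open>
  The space is an abstract topology \<open>X :: 'a topology\<close>. Functions on it are represented by total
  HOL functions whose values outside \<open>topspace X\<close> never matter.
\<close>

definition cont_fun :: "'a topology \<Rightarrow> ('a \<Rightarrow> 'f::real_normed_field) set" where
  "cont_fun X = {f. continuous_map X euclidean f}"

definition bcont_fun :: "'a topology \<Rightarrow> ('a \<Rightarrow> 'f::real_normed_field) set" where
  "bcont_fun X = {f \<in> cont_fun X. bounded (f ` topspace X)}"

definition zero_set :: "'a topology \<Rightarrow> ('a \<Rightarrow> real) \<Rightarrow> 'a set" where
  "zero_set X f = {x \<in> topspace X. f x = 0}"

definition zero_cozero_sets :: "'a topology \<Rightarrow> 'a set set" where
  "zero_cozero_sets X = zero_set X ` bcont_fun X \<union> (\<lambda>f. topspace X - zero_set X f) ` bcont_fun X"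

definition zero_algebra :: "'a topology \<Rightarrow> 'a set set" where
  "zero_algebra X = Sigma_Algebra.algebra (topspace X) hull zero_cozero_sets X"

definition zero_sigma_algebra :: "'a topology \<Rightarrow> 'a set set" where
  "zero_sigma_algebra X = sigma_sets (topspace X) (zero_cozero_sets X)"


definition order_bounded :: "'a topology \<Rightarrow> ('a \<Rightarrow> real) set \<Rightarrow> bool" where
  "order_bounded X V \<longleftrightarrow> V \<subseteq> cont_fun X \<and>
    (\<exists>f\<in>cont_fun X. \<exists>h\<in>cont_fun X. \<forall>u\<in>V. \<forall>x\<in>topspace X. f x \<le> u x \<and> u x \<le> h x)"

definition linear_functional :: "'a topology \<Rightarrow> (('a \<Rightarrow> real) \<Rightarrow> real) \<Rightarrow> bool" where
  "linear_functional X p \<longleftrightarrow>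
    (\<forall>f\<in>cont_fun X. \<forall>h\<in>cont_fun X. p (\<lambda>x. f x + h x) = p f + p h) \<and>
    (\<forall>f\<in>cont_fun X. \<forall>c. p (\<lambda>x. c * f x) = c * p f)"

definition bounded_functional :: "'a topology \<Rightarrow> (('a \<Rightarrow> real) \<Rightarrow> real) \<Rightarrow> bool" where
  "bounded_functional X p \<longleftrightarrow> (\<forall>V. order_bounded X V \<longrightarrow> bounded (p ` V))"

definition directed_set :: "'i set \<Rightarrow> ('i \<Rightarrow> 'i \<Rightarrow> bool) \<Rightarrow> bool" where
  "directed_set A leq \<longleftrightarrow> A \<noteq> {} \<and> (\<forall>i\<in>A. leq i i) \<and>
    (\<forall>i\<in>A. \<forall>j\<in>A. \<forall>k\<in>A. leq i j \<longrightarrow> leq j k \<longrightarrow> leq i k) \<and>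
    (\<forall>i\<in>A. \<forall>j\<in>A. \<exists>k\<in>A. leq i k \<and> leq j k)"

definition net_filter :: "'i set \<Rightarrow> ('i \<Rightarrow> 'i \<Rightarrow> bool) \<Rightarrow> 'i filter" where
  "net_filter A leq = (INF i\<in>A. principal {j \<in> A. leq i j})"

definition decreasing_to_zero ::
    "'a topology \<Rightarrow> 'i set \<Rightarrow> ('i \<Rightarrow> 'i \<Rightarrow> bool) \<Rightarrow> ('i \<Rightarrow> 'a \<Rightarrow> real) \<Rightarrow> bool" where
  "decreasing_to_zero X A leq f \<longleftrightarrow>
    (\<forall>i\<in>A. f i \<in> cont_fun X) \<and>
    (\<forall>i\<in>A. \<forall>j\<in>A. leq i j \<longrightarrow> (\<forall>x\<in>topspace X. f i x \<ge> f j x \<and> f j x \<ge> 0)) \<and>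
    (\<forall>x\<in>topspace X. ((\<lambda>i. f i x) \<longlongrightarrow> 0) (net_filter A leq))"

text \<open>
  A definition cannot quantify over all index types of nets. Index sets drawn from the type
  \<open>'a \<Rightarrow> real\<close> suffice, since a decreasing net can be re-indexed by the set of its members;
  \<open>tau_smooth_functional_net\<close> below gives the property for nets over an arbitrary index type.
\<close>

definition tau_smooth_functional :: "'a topology \<Rightarrow> (('a \<Rightarrow> real) \<Rightarrow> real) \<Rightarrow> bool" where
  "tau_smooth_functional X p \<longleftrightarrow> linear_functional X p \<and> bounded_functional X p \<and>
    (\<forall>(A :: ('a \<Rightarrow> real) set) leq f. directed_set A leq \<longrightarrow> decreasing_to_zero X A leq f \<longrightarrow>
      ((\<lambda>i. p (f i)) \<longlongrightarrow> 0) (net_filter A leq))"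

lemma eventually_net_filter:
  assumes "directed_set A leq"
  shows "eventually P (net_filter A leq) \<longleftrightarrow> (\<exists>i\<in>A. \<forall>j\<in>A. leq i j \<longrightarrow> P j)"
proof -
  have "eventually P (net_filter A leq) \<longleftrightarrow> (\<exists>i\<in>A. eventually P (principal {j \<in> A. leq i j}))"
    unfolding net_filter_def
  proof (rule eventually_INF_base)
    show "A \<noteq> {}" using assms by (simp add: directed_set_def)
    fix i j assume ij: "i \<in> A" "j \<in> A"
    with assms obtain k where k: "k \<in> A" "leq i k" "leq j k"
      unfolding directed_set_def by blast
    have tr: "\<forall>i\<in>A. \<forall>j\<in>A. \<forall>k\<in>A. leq i j \<longrightarrow> leq j k \<longrightarrow> leq i k"
      using assms unfolding directed_set_def by blast
    show "\<exists>x\<in>A. principal {j \<in> A. leq x j} \<le> inf (principal {j \<in> A. leq i j}) (principal {k \<in> A. leq j k})"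
    proof (intro bexI[of _ k] inf_greatest)
      have "{l \<in> A. leq k l} \<subseteq> {l \<in> A. leq i l}"
        using tr[rule_format, OF ij(1) k(1)] k(2) by blast
      then show "principal {l \<in> A. leq k l} \<le> principal {l \<in> A. leq i l}" by simp
      have "{l \<in> A. leq k l} \<subseteq> {l \<in> A. leq j l}"
        using tr[rule_format, OF ij(2) k(1)] k(3) by blast
      then show "principal {l \<in> A. leq k l} \<le> principal {l \<in> A. leq j l}" by simp
    qed (rule k(1))
  qed
  also have "\<dots> \<longleftrightarrow> (\<exists>i\<in>A. \<forall>j\<in>A. leq i j \<longrightarrow> P j)"
    unfolding eventually_principal by blast
  finally show ?thesis .
qed

lemma tau_smooth_functional_net:
  fixes A :: "'i set" and f :: "'i \<Rightarrow> 'a \<Rightarrow> real"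
  assumes p: "tau_smooth_functional X p"
    and A: "directed_set A leq" and f: "decreasing_to_zero X A leq f"
  shows "((\<lambda>i. p (f i)) \<longlongrightarrow> 0) (net_filter A leq)"
proof -
  define D where "D = f ` A"
  define ge where "ge = (\<lambda>u v :: 'a \<Rightarrow> real. \<forall>x\<in>topspace X. v x \<le> u x)"
  have mono: "ge (f i) (f j)" if "i \<in> A" "j \<in> A" "leq i j" for i j
    using f that unfolding decreasing_to_zero_def ge_def by blast
  have D: "directed_set D ge"
    unfolding directed_set_def
  proof (intro conjI ballI impI)
    show "D \<noteq> {}" using A by (auto simp: D_def directed_set_def)
    show "ge u u" for u by (simp add: ge_def)
    show "ge u w" if "ge u v" "ge v w" for u v w
      using that unfolding ge_def by (meson order_trans)
    fix u v assume "u \<in> D" "v \<in> D"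
    then obtain i j where ij: "i \<in> A" "u = f i" "j \<in> A" "v = f j" by (auto simp: D_def)
    then obtain k where "k \<in> A" "leq i k" "leq j k" using A unfolding directed_set_def by blast
    with ij show "\<exists>k\<in>D. ge u k \<and> ge v k" by (intro bexI[of _ "f k"]) (auto simp: D_def mono)
  qed
  have nn: "0 \<le> f i x" if "i \<in> A" "x \<in> topspace X" for i x
  proof -
    have "leq i i" using A that unfolding directed_set_def by blast
    then show ?thesis using f that unfolding decreasing_to_zero_def by blast
  qed
  have Df: "decreasing_to_zero X D ge (\<lambda>u. u)"
    unfolding decreasing_to_zero_def
  proof (intro conjI ballI impI)
    show "u \<in> cont_fun X" if "u \<in> D" for u
      using that f by (auto simp: D_def decreasing_to_zero_def)
    show "v x \<le> u x" if "ge u v" "x \<in> topspace X" for u v x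
      using that by (simp add: ge_def)
    show "0 \<le> v x" if "v \<in> D" "x \<in> topspace X" for v x
      using that nn by (auto simp: D_def)
    fix x assume x: "x \<in> topspace X"
    show "((\<lambda>u. u x) \<longlongrightarrow> 0) (net_filter D ge)"
    proof (rule tendstoI)
      fix e :: real assume "e > 0"
      have "((\<lambda>i. f i x) \<longlongrightarrow> 0) (net_filter A leq)"
        using f x by (auto simp: decreasing_to_zero_def)
      from tendstoD[OF this \<open>e > 0\<close>] obtain i where
        i: "i \<in> A" "\<forall>j\<in>A. leq i j \<longrightarrow> dist (f j x) 0 < e"
        unfolding eventually_net_filter[OF A] by blast
      have "leq i i" using A i unfolding directed_set_def by blast
      with i have ie: "f i x < e" by fastforce
      have "dist (v x) 0 < e" if "v \<in> D" "ge (f i) v" for v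
      proof -
        have "v x \<le> f i x" using that x by (simp add: ge_def)
        moreover have "0 \<le> v x" using that nn x by (auto simp: D_def)
        ultimately show ?thesis using ie by simp
      qed
      then show "\<forall>\<^sub>F u in net_filter D ge. dist (u x) 0 < e"
        unfolding eventually_net_filter[OF D] using i by (intro bexI[of _ "f i"]) (auto simp: D_def)
    qed
  qed
  have "((\<lambda>u. p u) \<longlongrightarrow> 0) (net_filter D ge)"
    using p D Df unfolding tau_smooth_functional_def by blast
  show ?thesis
  proof (rule tendstoI)
    fix e :: real assume "e > 0"
    from tendstoD[OF \<open>((\<lambda>u. p u) \<longlongrightarrow> 0) (net_filter D ge)\<close> this]
    obtain i where "i \<in> A" "\<forall>v\<in>D. ge (f i) v \<longrightarrow> dist (p v) 0 < e"
      unfolding eventually_net_filter[OF D] by (auto simp: D_def)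
    then show "\<forall>\<^sub>F i in net_filter A leq. dist (p (f i)) 0 < e"
      unfolding eventually_net_filter[OF A] using mono by (intro bexI[of _ i]) (auto simp: D_def)
  qed
qed


text \<open>
  Integrability of the constant function 1 forces the measure to be finite.
\<close>

definition tau_smooth_measure :: "'a topology \<Rightarrow> 'a measure \<Rightarrow> bool" where
  "tau_smooth_measure X m \<longleftrightarrow>
    space m = topspace X \<and> sets m = zero_sigma_algebra X \<and>
    (\<forall>f\<in>cont_fun X. integrable m (f :: 'a \<Rightarrow> real)) \<and>
    tau_smooth_functional X (\<lambda>f. \<integral>x. f x \<partial>m)"

text \<open>
  The measure \<open>A \<mapsto> m (g\<inverse>A)\<close>; see \<open>emeasure_translate\<close> below.
\<close>

definition translate :: "('g \<Rightarrow> 'a \<Rightarrow> 'a) \<Rightarrow> 'g \<Rightarrow> 'a measure \<Rightarrow> 'a measure" where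
  "translate h g m = distr m m (h g)"

text \<open>
  A non-negative measure is its own variation. For finite measures on the generated
  sigma-algebra, absolute continuity tested on the generating algebra, on the whole
  sigma-algebra, in terms of null sets or by an epsilon-delta condition, is the same, because
  the measures are inner regular with respect to zero sets.
\<close>

definition equivalent_measures :: "'a measure \<Rightarrow> 'a measure \<Rightarrow> bool" where
  "equivalent_measures m n \<longleftrightarrow> absolutely_continuous n m \<and> absolutely_continuous m n"

definition quasi_invariant ::
    "('g, 'b) monoid_scheme \<Rightarrow> ('g \<Rightarrow> 'a \<Rightarrow> 'a) \<Rightarrow> 'a measure \<Rightarrow> bool" where
  "quasi_invariant G h m \<longleftrightarrow> (\<forall>g\<in>carrier G. equivalent_measures (translate h g m) m)"

definition Q_tau_plus ::
    "'a topology \<Rightarrow> ('g, 'b) monoid_scheme \<Rightarrow> ('g \<Rightarrow> 'a \<Rightarrow> 'a) \<Rightarrow> 'a measure set" where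
  "Q_tau_plus X G h = {m. tau_smooth_measure X m \<and> quasi_invariant G h m}"

text \<open>
  The supremum is a genuine one: for bounded \<open>f\<close> the integrals against the finite measures
  \<open>translate h g m\<close> are bounded uniformly in \<open>g\<close>, and a group is not empty.
\<close>

definition tau_s_nbhd ::
    "'a topology \<Rightarrow> ('g, 'b) monoid_scheme \<Rightarrow> ('g \<Rightarrow> 'a \<Rightarrow> 'a) \<Rightarrow> 'a measure \<Rightarrow>
      ('a \<Rightarrow> 'f::{real_normed_field, banach, second_countable_topology}) set \<Rightarrow> real \<Rightarrow>
      'a measure set" where
  "tau_s_nbhd X G h m0 fs y = {m \<in> Q_tau_plus X G h. \<forall>f\<in>fs.
     (SUP g\<in>carrier G. norm ((\<integral>x. f x \<partial>translate h g m) - (\<integral>x. f x \<partial>translate h g m0))) < y}"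

text \<open>
  The topology on \<open>Q_tau_plus X G h\<close>; the token \<open>TYPE('f)\<close> selects the scalar field of the test
  functions. It is the subspace topology inherited from any larger family of measures carrying the
  same neighbourhoods, as these are finite intersections of pseudometric balls around \<open>m0\<close>.
\<close>

definition tau_s ::
    "'f::{real_normed_field, banach, second_countable_topology} itself \<Rightarrow>
      'a topology \<Rightarrow> ('g, 'b) monoid_scheme \<Rightarrow> ('g \<Rightarrow> 'a \<Rightarrow> 'a) \<Rightarrow> 'a measure topology" where
  "tau_s _ X G h = topology (\<lambda>U. U \<subseteq> Q_tau_plus X G h \<and>
     (\<forall>m0\<in>U. \<exists>fs y. finite fs \<and> fs \<subseteq> (bcont_fun X :: ('a \<Rightarrow> 'f) set) \<and> y > 0 \<and>
        tau_s_nbhd X G h m0 fs y \<subseteq> U))"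

lemma openin_tau_s:
  "openin (tau_s TYPE('f::{real_normed_field, banach, second_countable_topology}) X G h) U \<longleftrightarrow>
    U \<subseteq> Q_tau_plus X G h \<and>
    (\<forall>m0\<in>U. \<exists>fs y. finite fs \<and> fs \<subseteq> (bcont_fun X :: ('a \<Rightarrow> 'f) set) \<and> y > 0 \<and>
       tau_s_nbhd X G h m0 fs y \<subseteq> U)"
proof -
  have "istopology (\<lambda>U. U \<subseteq> Q_tau_plus X G h \<and>
    (\<forall>m0\<in>U. \<exists>fs y. finite fs \<and> fs \<subseteq> (bcont_fun X :: ('a \<Rightarrow> 'f) set) \<and> y > 0 \<and>
       tau_s_nbhd X G h m0 fs y \<subseteq> U))" (is "istopology ?P")
    unfolding istopology_def
  proof (intro conjI allI impI)
    fix S T assume S: "?P S" and T: "?P T"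
    show "S \<inter> T \<subseteq> Q_tau_plus X G h" using S by blast
    show "\<forall>m0\<in>S \<inter> T. \<exists>fs y. finite fs \<and> fs \<subseteq> (bcont_fun X :: ('a \<Rightarrow> 'f) set) \<and> y > 0 \<and>
       tau_s_nbhd X G h m0 fs y \<subseteq> S \<inter> T"
    proof
      fix m0 assume m0: "m0 \<in> S \<inter> T"
      obtain fs y where 1: "finite fs" "fs \<subseteq> (bcont_fun X :: ('a \<Rightarrow> 'f) set)" "y > 0"
        "tau_s_nbhd X G h m0 fs y \<subseteq> S" using S m0 by blast
      obtain fs' y' where 2: "finite fs'" "fs' \<subseteq> (bcont_fun X :: ('a \<Rightarrow> 'f) set)" "y' > 0"
        "tau_s_nbhd X G h m0 fs' y' \<subseteq> T" using T m0 by blast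
      have "tau_s_nbhd X G h m0 (fs \<union> fs') (min y y') \<subseteq>
          tau_s_nbhd X G h m0 fs y \<inter> tau_s_nbhd X G h m0 fs' y'"
        by (auto simp: tau_s_nbhd_def)
      with 1 2 show "\<exists>fs y. finite fs \<and> fs \<subseteq> (bcont_fun X :: ('a \<Rightarrow> 'f) set) \<and> y > 0 \<and>
         tau_s_nbhd X G h m0 fs y \<subseteq> S \<inter> T"
        by (intro exI[of _ "fs \<union> fs'"] exI[of _ "min y y'"]) auto
    qed
  next
    fix K assume K: "\<forall>U\<in>K. ?P U"
    show "\<Union>K \<subseteq> Q_tau_plus X G h" using K by blast
    show "\<forall>m0\<in>\<Union>K. \<exists>fs y. finite fs \<and> fs \<subseteq> (bcont_fun X :: ('a \<Rightarrow> 'f) set) \<and> y > 0 \<and>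
       tau_s_nbhd X G h m0 fs y \<subseteq> \<Union>K"
    proof
      fix m0 assume "m0 \<in> \<Union>K"
      then obtain U where U: "U \<in> K" "m0 \<in> U" by blast
      have "\<exists>fs y. finite fs \<and> fs \<subseteq> (bcont_fun X :: ('a \<Rightarrow> 'f) set) \<and> y > 0 \<and>
         tau_s_nbhd X G h m0 fs y \<subseteq> U" using bspec[OF K U(1)] U(2) by (elim conjE) (rule bspec)
      moreover have "U \<subseteq> \<Union>K" using U(1) by (rule Union_upper)
      ultimately show "\<exists>fs y. finite fs \<and> fs \<subseteq> (bcont_fun X :: ('a \<Rightarrow> 'f) set) \<and> y > 0 \<and>
         tau_s_nbhd X G h m0 fs y \<subseteq> \<Union>K" by (meson subset_trans)
    qed
  qed
  from topology_inverse'[OF this] show ?thesis unfolding tau_s_def by (rule fun_cong)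
qed

lemma topspace_tau_s:
  "topspace (tau_s TYPE('f::{real_normed_field, banach, second_countable_topology}) X G h) =
    Q_tau_plus X G h"
proof (rule antisym)
  show "topspace (tau_s TYPE('f) X G h) \<subseteq> Q_tau_plus X G h"
    using openin_topspace[of "tau_s TYPE('f) X G h"] unfolding openin_tau_s by blast
  have "openin (tau_s TYPE('f) X G h) (Q_tau_plus X G h)"
    unfolding openin_tau_s
  proof (intro conjI ballI)
    fix m0
    have "tau_s_nbhd X G h m0 ({} :: ('a \<Rightarrow> 'f) set) 1 \<subseteq> Q_tau_plus X G h"
      by (auto simp: tau_s_nbhd_def)
    then show "\<exists>fs y. finite fs \<and> fs \<subseteq> (bcont_fun X :: ('a \<Rightarrow> 'f) set) \<and> y > 0 \<and>
        tau_s_nbhd X G h m0 fs y \<subseteq> Q_tau_plus X G h"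
      by (metis empty_subsetI finite.emptyI zero_less_one)
  qed simp
  then show "Q_tau_plus X G h \<subseteq> topspace (tau_s TYPE('f) X G h)"
    by (rule openin_subset)
qed

lemma zero_cozero_sets_subset_zero_algebra: "zero_cozero_sets X \<subseteq> zero_algebra X"
  unfolding zero_algebra_def by (rule hull_subset)

lemma zero_algebra_subset_zero_sigma_algebra: "zero_algebra X \<subseteq> zero_sigma_algebra X"
  unfolding zero_algebra_def
proof (rule hull_minimal)
  have P: "zero_cozero_sets X \<subseteq> Pow (topspace X)"
    by (auto simp: zero_cozero_sets_def zero_set_def)
  show "zero_cozero_sets X \<subseteq> zero_sigma_algebra X"
    by (auto simp: zero_sigma_algebra_def)
  interpret sigma_algebra "topspace X" "zero_sigma_algebra X"
    unfolding zero_sigma_algebra_def using P by (rule sigma_algebra_sigma_sets)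
  show "Sigma_Algebra.algebra (topspace X) (zero_sigma_algebra X)" ..
qed

lemma emeasure_translate:
  assumes act: "group_action G (topspace X) h"
    and inv: "\<And>g A. g \<in> carrier G \<Longrightarrow> A \<in> zero_algebra X \<Longrightarrow> h g ` A \<in> zero_algebra X"
    and m: "space m = topspace X" "sets m = zero_sigma_algebra X"
    and g: "g \<in> carrier G" and A: "A \<in> sets m"
  shows "emeasure (translate h g m) A = emeasure m (h (inv\<^bsub>G\<^esub> g) ` A)"
proof -
  interpret group_action G "topspace X" h by (rule act)
  interpret group G using group_hom group_hom.axioms(1) by blast
  have gi: "inv\<^bsub>G\<^esub> g \<in> carrier G" using g by simp
  have vim: "h g -` B \<inter> topspace X = h (inv\<^bsub>G\<^esub> g) ` B" if "B \<subseteq> topspace X" for B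
  proof (intro equalityI subsetI)
    fix x assume x: "x \<in> h g -` B \<inter> topspace X"
    then have "h (inv\<^bsub>G\<^esub> g) (h g x) = x" using orbit_sym_aux[OF g _ refl, of x] x by simp
    then have "x = h (inv\<^bsub>G\<^esub> g) (h g x)" by (rule sym)
    with x show "x \<in> h (inv\<^bsub>G\<^esub> g) ` B" by (intro image_eqI[of _ _ "h g x"]) simp_all
  next
    fix x assume "x \<in> h (inv\<^bsub>G\<^esub> g) ` B"
    then obtain b where b: "b \<in> B" "x = h (inv\<^bsub>G\<^esub> g) b" by blast
    have bX: "b \<in> topspace X" using b that by blast
    have "h g x = b" using orbit_sym_aux[OF gi bX refl] b g by simp
    moreover have "x \<in> topspace X" using element_image[OF gi bX refl] b by simp
    ultimately show "x \<in> h g -` B \<inter> topspace X" using b by simp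
  qed
  have "h g \<in> measurable m m"
  proof (rule measurable_sigma_sets[where \<Omega> = "topspace X" and A = "zero_cozero_sets X"])
    show "sets m = sigma_sets (topspace X) (zero_cozero_sets X)"
      using m by (simp add: zero_sigma_algebra_def)
    show P: "zero_cozero_sets X \<subseteq> Pow (topspace X)"
      by (auto simp: zero_cozero_sets_def zero_set_def)
    show "h g \<in> space m \<rightarrow> topspace X" using element_image[OF g _ refl] m by (intro funcsetI) simp
    fix B assume B: "B \<in> zero_cozero_sets X"
    have "h g -` B \<inter> space m = h (inv\<^bsub>G\<^esub> g) ` B" using vim[of B] B P m by (metis PowD subsetD)
    also have "\<dots> \<in> sets m"
      using inv[OF gi] B zero_cozero_sets_subset_zero_algebra
        zero_algebra_subset_zero_sigma_algebra m by blast
    finally show "h g -` B \<inter> space m \<in> sets m" .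
  qed
  then show ?thesis
    unfolding translate_def using A vim[of A] sets.sets_into_space[OF A] m
    by (simp add: emeasure_distr)
qed

end

theory Submission
  imports Defs
begin

text \<open>
  A \<open>\<tau>\<close>-smooth measure integrates every continuous function, bounded or not. On a metrizable space this
  forces its support \<open>K\<close> to be compact: the complement of the support is null by \<open>\<tau>\<close>-smoothness
  (\<open>tau_smooth_AE_msupport\<close>), and a continuous function that is unbounded on the support could be
  composed with a rapidly increasing function to give a non-integrable one
  (\<open>tau_smooth_compact_msupport\<close>). By quasi-invariance, all translates \<open>m\<^sup>g\<close> live on the same compact
  set \<open>K\<close> (\<open>translate_AE_msupport\<close>), although the maps of the group are not assumed to be continuous.
  
  Fix a compatible metric on the space. The topology \<open>\<tau>\<^sub>s(G)\<close> is that of the metric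
  \<open>sup\<^sub>g sup\<^sub>\<phi> |\<integral> \<phi> d(m\<^sup>g - n\<^sup>g)|\<close>, with \<open>\<phi>\<close> ranging over the 1-Lipschitz functions bounded by 1
  (\<open>bl_dist\<close>). To compare the two near \<open>m0\<close>, take a finite Lipschitz partition of unity \<open>f\<^sub>s\<close> on the
  support of \<open>m0\<close>, subordinate to small balls. A function \<open>\<phi>\<close> that oscillates little on these balls
  is close to \<open>\<Sum>\<^sub>s \<phi>(s) f\<^sub>s\<close> where the partition sums to 1; a measure \<open>n\<close> whose translates integrate
  1 and the \<open>f\<^sub>s\<close> nearly as those of \<open>m0\<close> do puts little mass elsewhere. Hence the integrals of \<open>\<phi>\<close>
  against \<open>n\<^sup>g\<close> and \<open>m0\<^sup>g\<close> are close, uniformly in \<open>g\<close> (\<open>partition_estimate\<close>). For \<open>\<phi>\<close> a fixed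
  bounded continuous function, whose oscillation is uniformly small near the compact support, this
  shows that small balls lie in a given neighbourhood. For \<open>\<phi>\<close> ranging over the Lipschitz functions
  it shows that finitely many test functions control the metric.
\<close>

section \<open>Bounded Lipschitz functions and zero sets in a metric space\<close>

context Metric_space
begin

text \<open>
  The test functions of the metric: 1-Lipschitz on \<open>M\<close> and bounded by 1 there. Nothing is required
  outside \<open>M\<close>.
\<close>

definition BL :: "('a \<Rightarrow> real) set" where
  "BL = {\<phi>. (\<forall>x\<in>M. \<bar>\<phi> x\<bar> \<le> 1) \<and> (\<forall>x\<in>M. \<forall>y\<in>M. \<bar>\<phi> x - \<phi> y\<bar> \<le> d x y)}"

text \<open>
  The distance from \<open>x\<close> to \<open>C\<close>, cut off at 1. Inserting 1 into the set makes \<open>cdist {}\<close> the constant 1.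
\<close>

definition cdist :: "'a set \<Rightarrow> 'a \<Rightarrow> real" where
  "cdist C x = Inf (insert 1 (d x ` C))"

lemma cont_fun_mtopology_iff:
  fixes f :: "'a \<Rightarrow> 'f::real_normed_field"
  shows "f \<in> cont_fun mtopology \<longleftrightarrow>
    (\<forall>a\<in>M. \<forall>\<epsilon>>0. \<exists>\<delta>>0. \<forall>x. x \<in> M \<and> d a x < \<delta> \<longrightarrow> dist (f a) (f x) < \<epsilon>)"
  using metric_continuous_map[OF Met_TC.Metric_space_axioms, of f]
  by (simp add: cont_fun_def)

lemma Lipschitz_imp_cont_fun:
  fixes f :: "'a \<Rightarrow> real"
  assumes "\<And>x y. x \<in> M \<Longrightarrow> y \<in> M \<Longrightarrow> \<bar>f x - f y\<bar> \<le> L * d x y"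
  shows "f \<in> cont_fun mtopology"
  unfolding cont_fun_mtopology_iff
proof (intro ballI allI impI)
  fix a and \<epsilon> :: real assume a: "a \<in> M" and e: "\<epsilon> > 0"
  show "\<exists>\<delta>>0. \<forall>x. x \<in> M \<and> d a x < \<delta> \<longrightarrow> dist (f a) (f x) < \<epsilon>"
  proof (intro exI[of _ "\<epsilon> / (1 + \<bar>L\<bar>)"] conjI allI impI)
    show "0 < \<epsilon> / (1 + \<bar>L\<bar>)" using e by simp
    fix x assume x: "x \<in> M \<and> d a x < \<epsilon> / (1 + \<bar>L\<bar>)"
    have "dist (f a) (f x) \<le> L * d a x" using assms a x by (simp add: dist_real_def)
    also have "\<dots> \<le> (1 + \<bar>L\<bar>) * d a x" by (intro mult_right_mono) auto
    also have "\<dots> < \<epsilon>" using x by (simp add: field_simps)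
    finally show "dist (f a) (f x) < \<epsilon>" .
  qed
qed

lemma BL_bcont_fun: "\<phi> \<in> BL \<Longrightarrow> \<phi> \<in> bcont_fun mtopology"
  unfolding bcont_fun_def bounded_iff
  by (auto simp: BL_def intro!: Lipschitz_imp_cont_fun[of \<phi> 1])

lemma BL_scaled_cont_fun:
  assumes c: "c > 0" and u: "(\<lambda>x. c * u x) \<in> BL"
  shows "u \<in> cont_fun mtopology"
proof (rule Lipschitz_imp_cont_fun[of _ "inverse c"])
  fix x y assume "x \<in> M" "y \<in> M"
  then have "\<bar>c * u x - c * u y\<bar> \<le> d x y" using u by (simp add: BL_def)
  then have "c * \<bar>u x - u y\<bar> \<le> d x y" using c by (simp add: right_diff_distrib[symmetric] abs_mult)
  then show "\<bar>u x - u y\<bar> \<le> inverse c * d x y" using c by (simp add: field_simps)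
qed

lemma bdd_below_distances [simp]: "bdd_below (d x ` C)"
  by (rule bdd_belowI[of _ 0]) auto

lemma cdist_le: "y \<in> C \<Longrightarrow> cdist C x \<le> d x y"
  unfolding cdist_def by (rule cInf_lower) auto

lemma cdist_le_1: "cdist C x \<le> 1"
  unfolding cdist_def by (rule cInf_lower) auto

lemma cdist_nonneg: "0 \<le> cdist C x"
  unfolding cdist_def by (rule cInf_greatest) auto

lemma cdist_eq_0: "x \<in> M \<Longrightarrow> x \<in> C \<Longrightarrow> cdist C x = 0"
  using cdist_le[of x C x] cdist_nonneg[of C x] by simp

lemma cdist_pos:
  assumes "closedin mtopology C" "x \<in> M" "x \<notin> C"
  shows "0 < cdist C x"
proof -
  have "openin mtopology (M - C)" using assms(1) by (simp add: closedin_def)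
  then obtain r where r: "r > 0" "mball x r \<subseteq> M - C"
    using assms by (auto simp: openin_mtopology)
  have "min 1 r \<le> cdist C x" unfolding cdist_def
  proof (rule cInf_greatest)
    fix t assume "t \<in> insert 1 (d x ` C)"
    moreover have "r \<le> d x y" if "y \<in> C" for y
    proof (rule ccontr)
      assume "\<not> r \<le> d x y"
      then have "y \<in> mball x r" 
        using that assms closedin_subset[OF assms(1)] by auto
      then show False using r that by blast
    qed
    ultimately show "min 1 r \<le> t" by (auto simp: min_le_iff_disj)
  qed simp
  then show ?thesis using r by linarith
qed

lemma cdist_BL:
  assumes "C \<subseteq> M"
  shows "cdist C \<in> BL"
proof -
  have *: "cdist C x \<le> cdist C y + d x y" if "x \<in> M" "y \<in> M" for x y
  proof -
    have "cdist C x - d x y \<le> cdist C y"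
      unfolding cdist_def[of C y]
    proof (rule cInf_greatest)
      fix t assume "t \<in> insert 1 (d y ` C)"
      then consider "t = 1" | z where "z \<in> C" "t = d y z" by auto
      then show "cdist C x - d x y \<le> t"
      proof cases
        case 1
        then show ?thesis using cdist_le_1[of C x] nonneg[of x y] by linarith
      next
        case 2
        then show ?thesis using cdist_le[of z C x] triangle[of x y z] that assms by auto
      qed
    qed simp
    then show ?thesis by simp
  qed
  show ?thesis unfolding BL_def
  proof (intro CollectI conjI ballI)
    fix x y assume "x \<in> M" "y \<in> M"
    then show "\<bar>cdist C x - cdist C y\<bar> \<le> d x y"
      using *[of x y] *[of y x] by (simp add: commute abs_le_iff)
  qed (simp add: cdist_nonneg cdist_le_1 abs_of_nonneg)
qed

lemma const_BL: "(\<lambda>_. 1) \<in> BL"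
  by (simp add: BL_def)

lemma zero_set_closedin:
  assumes "f \<in> cont_fun mtopology"
  shows "closedin mtopology (zero_set mtopology f)"
proof -
  have "closedin mtopology {x \<in> topspace mtopology. f x \<in> {0}}"
    using assms unfolding cont_fun_def by (intro closedin_continuous_map_preimage) auto
  then show ?thesis by (simp add: zero_set_def)
qed

text \<open>
  In a metric space the zero sets of bounded continuous functions are exactly the closed sets, so
  \<open>zero_sigma_algebra\<close> is the Borel sigma-algebra.
\<close>

lemma closedin_is_zero_set:
  assumes "closedin mtopology C"
  shows "C = zero_set mtopology (cdist C)"
  using cdist_eq_0 cdist_pos[OF assms] closedin_subset[OF assms]
  by (fastforce simp: zero_set_def)

lemma closedin_zero_cozero: "closedin mtopology C \<Longrightarrow> C \<in> zero_cozero_sets mtopology"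
  unfolding zero_cozero_sets_def
  by (metis BL_bcont_fun UnI1 cdist_BL closedin_is_zero_set closedin_subset image_eqI 
      topspace_mtopology)

lemma zero_sigma_algebra_closedin:
  "zero_sigma_algebra mtopology = sigma_sets M {C. closedin mtopology C}"
proof (rule antisym)
  show "zero_sigma_algebra mtopology \<subseteq> sigma_sets M {C. closedin mtopology C}"
    unfolding zero_sigma_algebra_def topspace_mtopology
  proof (rule sigma_sets_mono, rule subsetI)
    fix B assume "B \<in> zero_cozero_sets mtopology"
    then obtain f where "f \<in> cont_fun mtopology" "B = zero_set mtopology f \<or> B = M - zero_set mtopology f"
      unfolding zero_cozero_sets_def bcont_fun_def by auto
    then show "B \<in> sigma_sets M {C. closedin mtopology C}"
      using zero_set_closedin by (metis CollectI sigma_sets.Basic sigma_sets.Compl)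
  qed
  show "sigma_sets M {C. closedin mtopology C} \<subseteq> zero_sigma_algebra mtopology"
    unfolding zero_sigma_algebra_def topspace_mtopology
    by (rule sigma_sets_mono') (auto intro: closedin_zero_cozero)
qed

lemma closedin_sets:
  "closedin mtopology C \<Longrightarrow> sets m = zero_sigma_algebra mtopology \<Longrightarrow> C \<in> sets m"
  by (simp add: zero_sigma_algebra_closedin)

lemma openin_sets:
  assumes "openin mtopology U" "sets m = zero_sigma_algebra mtopology"
  shows "U \<in> sets m"
proof -
  have "U = M - (M - U)" using openin_subset[OF assms(1)] by auto
  moreover have "closedin mtopology (M - U)" using assms(1) by (metis openin_closedin_eq topspace_mtopology)
  ultimately show ?thesis unfolding assms(2) zero_sigma_algebra_closedin
    by (metis CollectI sigma_sets.Basic sigma_sets.Compl)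
qed

lemma cont_fun_measurable:
  fixes f :: "'a \<Rightarrow> 'f::real_normed_field"
  assumes f: "f \<in> cont_fun mtopology" and m: "space m = M" "sets m = zero_sigma_algebra mtopology"
  shows "f \<in> borel_measurable m"
proof (rule borel_measurableI)
  fix S :: "'f set" assume "open S"
  then have "openin mtopology {x \<in> topspace mtopology. f x \<in> S}"
    using f unfolding cont_fun_def by (intro openin_continuous_map_preimage) auto
  moreover have "f -` S \<inter> space m = {x \<in> topspace mtopology. f x \<in> S}" using m by auto
  ultimately show "f -` S \<inter> space m \<in> sets m" using openin_sets m by simp
qed

section \<open>Lipschitz partitions of unity near a compact set\<close>

lemma compactin_finite_net:
  assumes "compactin mtopology K" "r > 0"
  obtains S where "finite S" "S \<subseteq> K" "\<And>x. x \<in> K \<Longrightarrow> \<exists>s\<in>S. d x s < r"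
proof -
  have KM: "K \<subseteq> M" using compactin_subset_topspace[OF assms(1)] by simp
  have "mtotally_bounded K" using assms(1) compactin_imp_mtotally_bounded by blast
  then obtain S where S: "finite S" "S \<subseteq> K" "K \<subseteq> (\<Union>x\<in>S. mball x r)"
    using assms(2) unfolding mtotally_bounded_def by metis
  show thesis
  proof (rule that[OF S(1,2)])
    fix x assume "x \<in> K"
    then obtain s where "s \<in> S" "x \<in> mball s r" using S(3) by blast
    then show "\<exists>s\<in>S. d x s < r" by (metis commute in_mball)
  qed
qed

text \<open>
  Subordinate to balls of radius \<open>r\<close> there are finitely many Lipschitz functions with sum at most 1
  everywhere and equal to 1 on \<open>K\<close>; the factor \<open>c\<close> brings all of them into \<open>BL\<close>.
\<close>

lemma Lipschitz_partition:
  assumes K: "compactin mtopology K" and r: "r > 0"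
  obtains S f c where "finite S" "S \<subseteq> K" "c > 0"
    "\<And>s. s \<in> S \<Longrightarrow> (\<lambda>x. c * f s x) \<in> BL"
    "\<And>s x. s \<in> S \<Longrightarrow> x \<in> M \<Longrightarrow> 0 \<le> f s x"
    "\<And>s x. s \<in> S \<Longrightarrow> x \<in> M \<Longrightarrow> 0 < f s x \<Longrightarrow> d x s < r"
    "\<And>x. x \<in> M \<Longrightarrow> (\<Sum>s\<in>S. f s x) \<le> 1"
    "\<And>x. x \<in> K \<Longrightarrow> (\<Sum>s\<in>S. f s x) = (1::real)"
proof -
  obtain S where S: "finite S" "S \<subseteq> K" "\<And>x. x \<in> K \<Longrightarrow> \<exists>s\<in>S. d x s < r / 2"
    using compactin_finite_net[OF K, of "r / 2"] r by auto
  have KM: "K \<subseteq> M" using compactin_subset_topspace[OF K] by simp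
  define u where "u s x = max 0 (r - d x s)" for s x
  \<comment> \<open>Bounding the denominator below keeps the quotients Lipschitz away from \<open>K\<close>, where the sum may vanish.\<close>
  define D where "D x = max (r / 2) (\<Sum>s\<in>S. u s x)" for x
  define f where "f s x = u s x / D x" for s x
  define n where "n = real (card S)"
  define L where "L = (1 + n) * 2 / r"
  define c where "c = 1 / (1 + L)"
  have L: "L \<ge> 0" using r by (simp add: L_def n_def)
  have c: "c > 0" "c \<le> 1" "c * L \<le> 1" using L by (auto simp: c_def field_simps)
  have Dpos: "D x \<ge> r / 2" "D x > 0" for x using r by (auto simp: D_def)
  have u0: "0 \<le> u s x" for s x by (simp add: u_def)
  have usum: "u s x \<le> (\<Sum>s\<in>S. u s x)" if "s \<in> S" for s x
    using S(1) that u0 by (intro member_le_sum) auto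
  have uD: "u s x \<le> D x" if "s \<in> S" for s x using usum[OF that, of x] by (simp add: D_def)
  have uL: "\<bar>u s x - u s y\<bar> \<le> d x y" if "s \<in> S" "x \<in> M" "y \<in> M" for s x y
  proof -
    have s: "s \<in> M" using that S KM by auto
    have "d x s \<le> d x y + d y s" "d y s \<le> d x y + d x s"
      using triangle[of x y s] triangle[of y x s] that s by (auto simp: commute)
    then show ?thesis by (auto simp: u_def)
  qed
  have DL: "\<bar>D x - D y\<bar> \<le> n * d x y" if "x \<in> M" "y \<in> M" for x y
  proof -
    have "\<bar>(\<Sum>s\<in>S. u s x) - (\<Sum>s\<in>S. u s y)\<bar> \<le> (\<Sum>s\<in>S. \<bar>u s x - u s y\<bar>)"
      by (simp add: sum_subtractf[symmetric])
    also have "\<dots> \<le> (\<Sum>s\<in>S. d x y)" using uL that by (intro sum_mono) auto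
    also have "\<dots> = n * d x y" by (simp add: n_def)
    finally show ?thesis by (auto simp: D_def)
  qed
  have fL: "\<bar>f s x - f s y\<bar> \<le> L * d x y" if s: "s \<in> S" and x: "x \<in> M" and y: "y \<in> M" for s x y
  proof -
    have eq: "f s x - f s y = ((u s x - u s y) + (u s y / D y) * (D y - D x)) / D x"
      using Dpos(2)[of x] Dpos(2)[of y] by (simp add: f_def field_simps)
    have q: "0 \<le> u s y / D y" "u s y / D y \<le> 1" using u0[of s y] uD[OF s, of y] Dpos(2)[of y] by simp_all
    have "\<bar>(u s y / D y) * (D y - D x)\<bar> \<le> 1 * (n * d x y)"
      unfolding abs_mult using q DL[OF y x] by (intro mult_mono) (auto simp: commute)
    then have "\<bar>(u s x - u s y) + (u s y / D y) * (D y - D x)\<bar> \<le> (1 + n) * d x y"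
      using uL[OF s x y] unfolding distrib_right by linarith
    then have "\<bar>f s x - f s y\<bar> \<le> (1 + n) * d x y / D x"
      unfolding eq using Dpos(2)[of x] by (simp add: divide_right_mono)
    also have "\<dots> \<le> (1 + n) * d x y / (r / 2)"
      using Dpos[of x] r by (intro divide_left_mono) (auto simp: n_def)
    finally show ?thesis by (simp add: L_def field_simps)
  qed
  have f0: "0 \<le> f s x" for s x using u0 Dpos(2)[of x] by (simp add: f_def)
  have f1: "f s x \<le> 1" if "s \<in> S" for s x using uD[OF that] Dpos(2)[of x] by (simp add: f_def)
  have fsum: "(\<Sum>s\<in>S. f s x) = (\<Sum>s\<in>S. u s x) / D x" for x
    by (simp add: f_def sum_divide_distrib)
  show thesis
  proof (rule that[OF S(1,2) c(1)])
    fix s assume s: "s \<in> S"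
    have "\<bar>c * f s x\<bar> \<le> 1" for x
    proof -
      have "c * f s x \<le> 1 * 1" using c f0 f1[OF s] by (intro mult_mono) auto
      then show ?thesis using c f0 by (simp add: abs_mult)
    qed
    moreover have "\<bar>c * f s x - c * f s y\<bar> \<le> d x y" if "x \<in> M" "y \<in> M" for x y
    proof -
      have "\<bar>c * f s x - c * f s y\<bar> = c * \<bar>f s x - f s y\<bar>"
        using c by (simp add: abs_mult right_diff_distrib[symmetric])
      also have "\<dots> \<le> c * (L * d x y)" using fL[OF s that] c by (intro mult_left_mono) auto
      also have "\<dots> = (c * L) * d x y" by simp
      also have "\<dots> \<le> 1 * d x y" using c by (intro mult_right_mono) auto
      finally show ?thesis by simp
    qed
    ultimately show "(\<lambda>x. c * f s x) \<in> BL" by (simp add: BL_def)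
  next
    show "0 \<le> f s x" for s x by (rule f0)
  next
    fix s x assume "0 < f s x"
    then show "d x s < r" using Dpos(2)[of x] by (auto simp: f_def u_def zero_less_divide_iff split: if_splits)
  next
    show "(\<Sum>s\<in>S. f s x) \<le> 1" for x unfolding fsum using Dpos(2)[of x] by (simp add: D_def)
  next
    fix x assume "x \<in> K"
    then obtain s where s: "s \<in> S" "d x s < r / 2" using S(3) by blast
    then have "r / 2 \<le> u s x" unfolding u_def le_max_iff_disj by linarith
    also have "\<dots> \<le> (\<Sum>s\<in>S. u s x)" by (rule usum[OF s(1)])
    finally have "D x = (\<Sum>s\<in>S. u s x)" by (simp add: D_def)
    then show "(\<Sum>s\<in>S. f s x) = 1" unfolding fsum using Dpos(2)[of x] by simp
  qed
qed

text \<open>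
  Uniform continuity at a compact set: only \<open>s\<close> has to lie in \<open>K\<close>, \<open>x\<close> may be any point near it.
\<close>

lemma cont_fun_uniform_near_compact:
  fixes f :: "'a \<Rightarrow> 'f::real_normed_field"
  assumes f: "f \<in> cont_fun mtopology" and K: "compactin mtopology K" and e: "e > 0"
  obtains r where "r > 0" "\<And>x s. x \<in> M \<Longrightarrow> s \<in> K \<Longrightarrow> d x s < r \<Longrightarrow> norm (f x - f s) \<le> e"
proof -
  have KM: "K \<subseteq> M" using compactin_subset_topspace[OF K] by simp
  have "\<forall>a\<in>K. \<exists>\<delta>>0. \<forall>x. x \<in> M \<and> d a x < \<delta> \<longrightarrow> dist (f a) (f x) < e / 2"
    using f e KM unfolding cont_fun_mtopology_iff by (meson half_gt_zero subsetD)
  then obtain D where D: "\<And>a. a \<in> K \<Longrightarrow> D a > 0"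
    "\<And>a x. a \<in> K \<Longrightarrow> x \<in> M \<Longrightarrow> d a x < D a \<Longrightarrow> dist (f a) (f x) < e / 2" by metis
  have "\<exists>F. finite F \<and> F \<subseteq> (\<lambda>a. mball a (D a / 2)) ` K \<and> K \<subseteq> \<Union>F"
  proof (rule compactinD[OF K])
    show "K \<subseteq> \<Union>((\<lambda>a. mball a (D a / 2)) ` K)" using D(1) KM by fastforce
  qed auto
  then obtain F where F: "finite F" "F \<subseteq> (\<lambda>a. mball a (D a / 2)) ` K" "K \<subseteq> \<Union>F" by blast
  from finite_subset_image[OF F(1,2)] obtain A where
    A: "A \<subseteq> K" "finite A" "F = (\<lambda>a. mball a (D a / 2)) ` A" by blast
  have A3: "K \<subseteq> (\<Union>a\<in>A. mball a (D a / 2))" using F(3) A(3) by simp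
  \<comment> \<open>Inserting 1 covers the case of empty \<open>A\<close>.\<close>
  define r where "r = Min (insert 1 ((\<lambda>a. D a / 2) ` A))"
  show thesis
  proof (rule that)
    show "r > 0" unfolding r_def using A D(1) by (subst Min_gr_iff) auto
    fix x s assume x: "x \<in> M" and s: "s \<in> K" and xs: "d x s < r"
    obtain a where a: "a \<in> A" "s \<in> mball a (D a / 2)" using A3 s by blast
    have aK: "a \<in> K" using a A by auto
    have "r \<le> D a / 2" unfolding r_def using A a by (intro Min_le) auto
    moreover have "d a x \<le> d a s + d x s" using triangle[of a s x] a x by (auto simp: commute)
    ultimately have "d a x < D a" using a xs by auto
    then have 1: "dist (f a) (f x) < e / 2" using D(2) aK x by blast
    have "d a s < D a" using a D(1)[OF aK] by auto
    then have 2: "dist (f a) (f s) < e / 2" using D(2) aK s KM by blast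
    have "dist (f x) (f s) < e" using dist_triangle_half_l[of "f a" "f x" e "f s"] 1 2 
      by (metis dist_commute dist_triangle_half_r)
    then show "norm (f x - f s) \<le> e" by (simp add: dist_norm)
  qed
qed

end

section \<open>Measures that integrate every continuous function\<close>

lemma tau_smooth_measureD:
  assumes "tau_smooth_measure X m"
  shows "space m = topspace X" "sets m = zero_sigma_algebra X"
    "\<And>f::_ \<Rightarrow> real. f \<in> cont_fun X \<Longrightarrow> integrable m f"
    "tau_smooth_functional X (\<lambda>f. \<integral>x. f x \<partial>m)"
  using assms unfolding tau_smooth_measure_def by auto

lemma tau_smooth_measure_finite:
  assumes "tau_smooth_measure X m"
  shows "finite_measure m"
proof (rule finite_measureI)
  have "(\<lambda>_. 1::real) \<in> cont_fun X" by (simp add: cont_fun_def)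
  from tau_smooth_measureD(3)[OF assms this]
  show "emeasure m (space m) \<noteq> \<infinity>" by (simp add: integrable_iff_bounded)
qed

context Metric_space
begin

text \<open>
  The topological support: the points all of whose neighbourhoods have positive measure.
\<close>

definition msupport :: "'a measure \<Rightarrow> 'a set" where
  "msupport m = {x \<in> M. \<forall>r>0. emeasure m (mball x r) \<noteq> 0}"

lemma closedin_msupport:
  assumes "sets m = zero_sigma_algebra mtopology"
  shows "closedin mtopology (msupport m)"
proof -
  have "openin mtopology (M - msupport m)"
    unfolding openin_mtopology
  proof (intro conjI allI impI)
    fix x assume x: "x \<in> M - msupport m"
    then obtain r where r: "r > 0" "emeasure m (mball x r) = 0" by (auto simp: msupport_def)
    show "\<exists>r>0. mball x r \<subseteq> M - msupport m"
    proof (intro exI[of _ r] conjI subsetI)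
      fix y assume y: "y \<in> mball x r"
      then obtain s where s: "s > 0" "mball y s \<subseteq> mball x r"
        using openin_mball[of x r] by (auto simp: openin_mtopology)
      have "emeasure m (mball y s) \<le> emeasure m (mball x r)"
        using s(2) openin_sets[OF openin_mball assms] by (intro emeasure_mono) auto
      then have "emeasure m (mball y s) = 0" using r by simp
      then show "y \<in> M - msupport m" using s y by (auto simp: msupport_def)
    qed (use r in auto)
  qed auto
  then show ?thesis by (auto simp: closedin_def msupport_def)
qed

lemma emeasure_openin_msupport:
  assumes U: "openin mtopology U" and x: "x \<in> U" "x \<in> msupport m"
    and m: "sets m = zero_sigma_algebra mtopology"
  shows "emeasure m U \<noteq> 0"
proof -
  obtain r where r: "r > 0" "mball x r \<subseteq> U" using U x by (auto simp: openin_mtopology)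
  then have "emeasure m (mball x r) \<noteq> 0" using x by (auto simp: msupport_def)
  moreover have "emeasure m (mball x r) \<le> emeasure m U"
    using r(2) openin_sets[OF U m] by (rule emeasure_mono)
  ultimately show ?thesis by auto
qed

text \<open>
  For a non-separable space the support of a finite Borel measure may have a null complement only
  thanks to \<open>\<tau>\<close>-smoothness. With \<open>\<phi>\<close> the truncated distance to the support, the continuous functions
  between 0 and \<open>\<phi>\<close> that agree with \<open>\<phi>\<close> almost everywhere form a net decreasing to 0, while their
  integrals all equal that of \<open>\<phi>\<close>; so \<open>\<phi>\<close> vanishes almost everywhere.
\<close>

lemma tau_smooth_AE_msupport:
  assumes tau: "tau_smooth_measure mtopology m"
  shows "AE x in m. x \<in> msupport m"
proof -
  note m = tau_smooth_measureD[OF tau, unfolded topspace_mtopology]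
  define K where "K = msupport m"
  have K: "closedin mtopology K" unfolding K_def by (rule closedin_msupport[OF m(2)])
  have KM: "K \<subseteq> M" by (auto simp: K_def msupport_def)
  define \<phi> where "\<phi> = cdist K"
  have \<phi>: "\<phi> \<in> cont_fun mtopology" "\<And>x. 0 \<le> \<phi> x" "\<And>x. \<phi> x \<le> 1"
    using BL_bcont_fun[OF cdist_BL[OF KM]] by (auto simp: \<phi>_def bcont_fun_def cdist_nonneg cdist_le_1)
  define A where "A = {f \<in> cont_fun mtopology. (\<forall>x\<in>M. 0 \<le> f x \<and> f x \<le> \<phi> x) \<and> (AE x in m. f x = \<phi> x)}"
  define leq where "leq f g \<longleftrightarrow> (\<forall>x\<in>M. g x \<le> f x)" for f g :: "'a \<Rightarrow> real"
  have dir: "directed_set A leq"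
    unfolding directed_set_def
  proof (intro conjI ballI impI)
    have "\<phi> \<in> A" using \<phi> by (simp add: A_def)
    then show "A \<noteq> {}" by blast
    show "leq f f" for f by (simp add: leq_def)
    show "leq f g \<Longrightarrow> leq g k \<Longrightarrow> leq f k" for f g k by (meson leq_def order_trans)
    fix f g assume f: "f \<in> A" and g: "g \<in> A"
    have "(\<lambda>x. min (f x) (g x)) \<in> A"
      unfolding A_def
    proof (intro CollectI conjI ballI)
      show "(\<lambda>x. min (f x) (g x)) \<in> cont_fun mtopology"
        using f g by (auto simp: A_def cont_fun_def intro: continuous_map_real_min)
      have "AE x in m. f x = \<phi> x" "AE x in m. g x = \<phi> x" using f g by (auto simp: A_def)
      then show "AE x in m. min (f x) (g x) = \<phi> x" by eventually_elim simp
    qed (use f g in \<open>auto simp: A_def min_le_iff_disj\<close>)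
    then show "\<exists>k\<in>A. leq f k \<and> leq g k" by (rule bexI[rotated]) (auto simp: leq_def)
  qed
  have dec: "decreasing_to_zero mtopology A leq (\<lambda>f. f)"
    unfolding decreasing_to_zero_def topspace_mtopology
  proof (intro conjI ballI impI)
    fix x assume x: "x \<in> M"
    have "\<exists>f\<in>A. f x = 0"
    proof (cases "x \<in> K")
      case True
      then have "\<phi> x = 0" using cdist_eq_0 x by (simp add: \<phi>_def)
      moreover have "\<phi> \<in> A" using \<phi> by (simp add: A_def)
      ultimately show ?thesis by blast
    next
      case False
      then obtain r where r: "r > 0" "emeasure m (mball x r) = 0"
        using x by (auto simp: K_def msupport_def)
      \<comment> \<open>This agrees with \<open>\<phi>\<close> off the null ball around \<open>x\<close>, since \<open>\<phi> \<le> 1\<close>.\<close>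
      define f where "f = (\<lambda>y. min (\<phi> y) (inverse r * d x y))"
      have "(\<lambda>y. inverse r * d x y) \<in> cont_fun mtopology"
      proof (rule Lipschitz_imp_cont_fun[of _ "inverse r"])
        fix y z assume "y \<in> M" "z \<in> M"
        then have "\<bar>d x y - d x z\<bar> \<le> d y z"
          using triangle[of x y z] triangle[of x z y] x by (auto simp: commute)
        then show "\<bar>inverse r * d x y - inverse r * d x z\<bar> \<le> inverse r * d y z"
          using r by (simp add: right_diff_distrib[symmetric] abs_mult)
      qed
      then have "f \<in> cont_fun mtopology"
        using \<phi>(1) unfolding f_def by (auto simp: cont_fun_def intro: continuous_map_real_min)
      moreover have "AE y in m. f y = \<phi> y"
      proof (rule AE_I[of _ _ "mball x r"])
        show "{y \<in> space m. f y \<noteq> \<phi> y} \<subseteq> mball x r"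
        proof (rule subsetI)
          fix y assume y: "y \<in> {y \<in> space m. f y \<noteq> \<phi> y}"
          then have "inverse r * d x y < \<phi> y" by (auto simp: f_def)
          also have "\<phi> y \<le> 1" by (rule \<phi>)
          finally show "y \<in> mball x r" using r y m(1) x by (simp add: field_simps)
        qed
      qed (use r openin_sets[OF openin_mball m(2)] in auto)
      moreover have "0 \<le> f y" "f y \<le> \<phi> y" for y using \<phi>(2) r by (auto simp: f_def)
      ultimately have "f \<in> A" by (simp add: A_def)
      moreover have "f x = 0" using \<phi>(2)[of x] x by (simp add: f_def)
      ultimately show ?thesis by blast
    qed
    then obtain f where f: "f \<in> A" "f x = 0" by blast
    show "((\<lambda>f. f x) \<longlongrightarrow> 0) (net_filter A leq)"
    proof (rule tendstoI)
      fix e :: real assume e: "e > 0"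
      have "dist (g x) 0 < e" if "g \<in> A" "leq f g" for g
        using e that f x by (fastforce simp: A_def leq_def)
      then show "\<forall>\<^sub>F g in net_filter A leq. dist (g x) 0 < e"
        unfolding eventually_net_filter[OF dir] using f(1) by blast
    qed
  qed (auto simp: A_def leq_def)
  have lim: "((\<lambda>f. \<integral>x. f x \<partial>m) \<longlongrightarrow> 0) (net_filter A leq)"
    by (rule tau_smooth_functional_net[OF m(4) dir dec])
  have eq: "(\<integral>x. f x \<partial>m) = (\<integral>x. \<phi> x \<partial>m)" if "f \<in> A" for f
    using that m(3)[of f] m(3)[OF \<phi>(1)]
    by (intro integral_cong_AE) (auto simp: A_def)
  have "(\<integral>x. \<phi> x \<partial>m) = 0"
  proof (rule ccontr)
    assume "(\<integral>x. \<phi> x \<partial>m) \<noteq> 0"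
    then have "\<bar>\<integral>x. \<phi> x \<partial>m\<bar> > 0" by simp
    from tendstoD[OF lim this] obtain f where
      "f \<in> A" "\<And>g. g \<in> A \<Longrightarrow> leq f g \<Longrightarrow> dist (\<integral>x. g x \<partial>m) 0 < \<bar>\<integral>x. \<phi> x \<partial>m\<bar>"
      unfolding eventually_net_filter[OF dir] by blast
    moreover have "leq f f" by (simp add: leq_def)
    ultimately have "dist (\<integral>x. f x \<partial>m) 0 < \<bar>\<integral>x. \<phi> x \<partial>m\<bar>" "f \<in> A" by auto
    then show False using eq by simp
  qed
  then have "AE x in m. \<phi> x = 0"
    using integral_nonneg_eq_0_iff_AE[OF m(3)[OF \<phi>(1)]] \<phi>(2) by simp
  then show ?thesis
  proof (rule AE_mp, intro AE_I2 impI)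
    fix x assume "x \<in> space m" "\<phi> x = 0"
    then show "x \<in> msupport m" using cdist_pos[OF K, of x] m(1) by (auto simp: \<phi>_def K_def)
  qed
qed

text \<open>
  If \<open>f\<close> were unbounded on the support, every set \<open>{f > t}\<close> would have positive measure. Then
  \<open>G t\<close>, the integral of \<open>min 1 (f - t)\<^sup>+\<close>, is positive, decreasing and continuous in \<open>t\<close>, and
  \<open>1 / G (f x)\<close> is a continuous function whose integral over each \<open>{f > n}\<close> is at least 1. It
  cannot be integrable.
\<close>

lemma cont_fun_bounded_on_msupport:
  assumes m: "space m = M" "sets m = zero_sigma_algebra mtopology"
    and int: "\<And>f::'a \<Rightarrow> real. f \<in> cont_fun mtopology \<Longrightarrow> integrable m f"
    and fin: "finite_measure m"
    and f: "f \<in> cont_fun mtopology"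
  shows "\<exists>B::real. \<forall>x\<in>msupport m. f x \<le> B"
proof (rule ccontr)
  assume "\<nexists>B. \<forall>x\<in>msupport m. f x \<le> B"
  then have unb: "\<exists>x\<in>msupport m. B < f x" for B by (meson not_le)
  interpret finite_measure m by fact
  have fm[measurable]: "f \<in> borel_measurable m" by (rule cont_fun_measurable[OF f m])
  define c where "c t s = max 0 (min 1 (s - t))" for t s :: real
  have cm[measurable]: "(\<lambda>x. c t (f x)) \<in> borel_measurable m" for t
    unfolding c_def by measurable
  have ci: "integrable m (\<lambda>x. c t (f x))" for t
    by (rule integrable_const_bound[of _ 1]) (auto simp: c_def)
  define G where "G t = (\<integral>x. c t (f x) \<partial>m)" for t
  have sets: "{x \<in> space m. f x > t} \<in> sets m" for t by measurable
  have int_ind: "integrable m (indicator {x \<in> space m. f x > t} :: 'a \<Rightarrow> real)" for t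
    using sets by (intro integrable_real_indicator) (auto simp: less_top[symmetric])
  have pos: "measure m {x \<in> space m. f x > t} > 0" for t
  proof -
    obtain x where x: "x \<in> msupport m" "t < f x" using unb by blast
    have "openin mtopology {x \<in> topspace mtopology. f x \<in> {t<..}}"
      using f unfolding cont_fun_def by (intro openin_continuous_map_preimage) auto
    then have "emeasure m {x \<in> space m. f x > t} \<noteq> 0"
      using emeasure_openin_msupport[OF _ _ x(1) m(2)] x m(1) by (auto simp: msupport_def)
    then show ?thesis by (simp add: emeasure_eq_measure less_le)
  qed
  have Gge: "measure m {x \<in> space m. f x > t + 1} \<le> G t" for t
  proof -
    have "(\<integral>x. indicator {x \<in> space m. f x > t + 1} x \<partial>m) \<le> G t"
      unfolding G_def using int_ind ci
      by (intro integral_mono) (auto simp: c_def split: split_indicator)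
    then show ?thesis using sets by simp
  qed
  have Gle: "G t \<le> measure m {x \<in> space m. f x > t}" for t
  proof -
    have "G t \<le> (\<integral>x. indicator {x \<in> space m. f x > t} x \<partial>m)"
      unfolding G_def using int_ind ci
      by (intro integral_mono) (auto simp: c_def split: split_indicator)
    then show ?thesis using sets by simp
  qed
  have Gpos: "G t > 0" for t using pos[of "t + 1"] Gge[of t] by linarith
  have Gmono: "G t \<le> G s" if "s \<le> t" for s t
    unfolding G_def using ci that by (intro integral_mono) (auto simp: c_def)
  have GL: "\<bar>G t - G s\<bar> \<le> measure m (space m) * \<bar>t - s\<bar>" for s t
  proof -
    have "\<bar>G t - G s\<bar> = \<bar>\<integral>x. c t (f x) - c s (f x) \<partial>m\<bar>"
      unfolding G_def using ci by simp
    also have "\<dots> \<le> (\<integral>x. \<bar>c t (f x) - c s (f x)\<bar> \<partial>m)" by (rule integral_abs_bound)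
    also have "\<dots> \<le> (\<integral>x. \<bar>t - s\<bar> \<partial>m)"
      using ci by (intro integral_mono) (auto simp: c_def)
    finally show ?thesis by simp
  qed
  have "continuous_on UNIV G"
  proof (rule lipschitz_on_continuous_on)
    show "(measure m (space m))-lipschitz_on UNIV G"
      using GL by (intro lipschitz_onI) (auto simp: dist_real_def)
  qed
  then have "continuous_on UNIV (\<lambda>t. inverse (G t))"
    using Gpos by (intro continuous_on_inverse) (auto simp: less_imp_neq[symmetric])
  then have "continuous_map euclidean euclidean (\<lambda>t. inverse (G t))" by simp
  then have "(\<lambda>x. inverse (G (f x))) \<in> cont_fun mtopology"
    using f continuous_map_compose[of mtopology euclidean f euclidean "\<lambda>t. inverse (G t)"]
    by (simp add: cont_fun_def o_def)
  then have int: "integrable m (\<lambda>x. inverse (G (f x)))" by (rule int)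
  then have gm[measurable]: "(\<lambda>x. inverse (G (f x))) \<in> borel_measurable m" by simp
  define h where "h n x = indicator {x \<in> space m. f x > real n} x * inverse (G (f x))" for n x
  have hm: "h n \<in> borel_measurable m" for n
    unfolding h_def using sets by (intro borel_measurable_times borel_measurable_indicator gm) auto
  have "(\<lambda>n. \<integral>x. h n x \<partial>m) \<longlonglongrightarrow> (\<integral>x. 0 \<partial>m)"
  proof (rule integral_dominated_convergence[OF _ hm int])
    show "AE x in m. (\<lambda>n. h n x) \<longlonglongrightarrow> 0"
    proof (intro AE_I2 tendsto_eventually)
      fix x
      obtain N where "f x \<le> real N" using real_arch_simple by blast
      then show "\<forall>\<^sub>F n in sequentially. h n x = 0"
        by (intro eventually_sequentiallyI[of N]) (auto simp: h_def split: split_indicator)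
    qed
    show "AE x in m. norm (h n x) \<le> inverse (G (f x))" for n
      using Gpos by (intro AE_I2) (auto simp: h_def less_imp_le split: split_indicator)
  qed auto
  then have lim: "(\<lambda>n. \<integral>x. h n x \<partial>m) \<longlonglongrightarrow> 0" by simp
  have "1 \<le> (\<integral>x. h n x \<partial>m)" for n
  proof -
    have "1 \<le> inverse (G n) * measure m {x \<in> space m. f x > n}"
      using Gle[of n] Gpos[of n] by (simp add: field_simps)
    also have "\<dots> = (\<integral>x. inverse (G n) * indicator {x \<in> space m. f x > n} x \<partial>m)"
      using sets by simp
    also have "\<dots> \<le> (\<integral>x. h n x \<partial>m)"
    proof (rule integral_mono)
      show "integrable m (\<lambda>x. inverse (G (real n)) * indicator {x \<in> space m. f x > n} x)"
        using int_ind by simp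
      show "integrable m (h n)"
        unfolding h_def using sets int
        by (intro integrable_mult_indicator[where 'b = real, simplified]) auto
      show "inverse (G (real n)) * indicator {x \<in> space m. f x > n} x \<le> h n x" for x
        using Gmono[of n "f x"] Gpos by (auto simp: h_def split: split_indicator intro: le_imp_inverse_le)
    qed
    finally show ?thesis .
  qed
  then show False using LIMSEQ_le_const[OF lim, of 1] by auto
qed

text \<open>
  A non-compact closed set contains a closed discrete sequence; the Tietze extension of the function
  that numbers its terms is unbounded on the set.
\<close>

lemma compactin_if_cont_fun_bounded:
  assumes K: "closedin mtopology K"
    and bdd: "\<And>f::'a \<Rightarrow> real. f \<in> cont_fun mtopology \<Longrightarrow> \<exists>B. \<forall>x\<in>K. f x \<le> B"
  shows "compactin mtopology K"
proof (rule ccontr)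
  assume "\<not> compactin mtopology K"
  moreover have KM: "K \<subseteq> M" using closedin_subset[OF K] by simp
  ultimately obtain T where T: "T \<subseteq> K" "infinite T" "K \<inter> mtopology derived_set_of T = {}"
    by (auto simp: compactin_eq_Bolzano_Weierstrass)
  obtain x :: "nat \<Rightarrow> 'a" where x: "inj x" "range x \<subseteq> T"
    using infinite_countable_subset[OF T(2)] by blast
  define S where "S = range x"
  have SK: "S \<subseteq> K" using x T by (auto simp: S_def)
  have der: "mtopology derived_set_of S = {}"
  proof -
    have "mtopology derived_set_of S \<subseteq> mtopology derived_set_of T"
      using x by (intro derived_set_of_mono) (auto simp: S_def)
    moreover have "mtopology derived_set_of S \<subseteq> K"
      using derived_set_of_mono[OF SK] K by (meson closedin_contains_derived_set subset_trans)
    ultimately show ?thesis using T by blast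
  qed
  have S: "closedin mtopology S"
    using der SK KM by (simp add: closedin_contains_derived_set)
  have "subtopology mtopology S = discrete_topology S"
    using der SK KM by (simp add: subtopology_eq_discrete_topology_eq)
  then have cont: "continuous_map (subtopology mtopology S) euclideanreal (\<lambda>y. real (inv_into UNIV x y))"
    by (simp add: continuous_map_from_discrete_topology)
  obtain g where g: "continuous_map mtopology euclideanreal g" "\<And>y. y \<in> S \<Longrightarrow> g y = real (inv_into UNIV x y)"
    using Tietze_extension_realinterval[OF normal_space_mtopology S is_interval_univ _ cont]
    by (metis UNIV_not_empty subset_UNIV)
  obtain B where B: "\<forall>y\<in>K. g y \<le> B" using bdd[of g] g by (auto simp: cont_fun_def)
  obtain n where "B < real n" using reals_Archimedean2 by blast
  moreover have "g (x n) = real n" using g(2)[of "x n"] x(1) by (simp add: S_def)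
  moreover have "x n \<in> K" using SK by (auto simp: S_def)
  ultimately show False using B by fastforce
qed

lemma tau_smooth_compact_msupport:
  assumes tau: "tau_smooth_measure mtopology m"
  shows "compactin mtopology (msupport m)"
proof (rule compactin_if_cont_fun_bounded)
  note m = tau_smooth_measureD[OF tau, unfolded topspace_mtopology]
  show "closedin mtopology (msupport m)" by (rule closedin_msupport[OF m(2)])
  show "\<exists>B. \<forall>x\<in>msupport m. f x \<le> B" if "f \<in> cont_fun mtopology" for f :: "'a \<Rightarrow> real"
    using cont_fun_bounded_on_msupport[OF m(1,2,3) tau_smooth_measure_finite[OF tau] that] by simp
qed

end

section \<open>Comparing integrals by means of a partition of unity\<close>

text \<open>
  If the functions \<open>f s\<close> form a partition of unity on a set \<open>K\<close> of full \<open>N0\<close>-measure, and \<open>\<phi>\<close> is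
  within \<open>e\<close> of the value \<open>v s\<close> wherever \<open>f s\<close> is positive, then the difference of the integrals of
  \<open>\<phi>\<close> is controlled by those of the \<open>f s\<close> and of 1. The measure \<open>N\<close> need not be concentrated on \<open>K\<close>:
  what it puts where the partition sums to less than 1 is controlled by the same differences.
\<close>

lemma norm_integral_diff_le_partition:
  fixes \<phi> :: "'a \<Rightarrow> 'f::{banach, second_countable_topology}"
  assumes N: "finite_measure N" and N0: "finite_measure N0" and sets: "sets N0 = sets N"
    and S: "finite S" and f: "\<And>s. s \<in> S \<Longrightarrow> f s \<in> borel_measurable N"
    and \<phi>: "\<phi> \<in> borel_measurable N" and K: "AE x in N0. x \<in> K"
    and f0: "\<And>s x. s \<in> S \<Longrightarrow> x \<in> space N \<Longrightarrow> 0 \<le> f s x"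
    and fsum: "\<And>x. x \<in> space N \<Longrightarrow> (\<Sum>s\<in>S. f s x) \<le> 1"
    and fsum1: "\<And>x. x \<in> K \<Longrightarrow> (\<Sum>s\<in>S. f s x) = 1"
    and B: "\<And>x. x \<in> space N \<Longrightarrow> norm (\<phi> x) \<le> B" "\<And>s. s \<in> S \<Longrightarrow> norm (v s) \<le> B" "0 \<le> B"
    and e: "\<And>s x. s \<in> S \<Longrightarrow> x \<in> space N \<Longrightarrow> 0 < f s x \<Longrightarrow> norm (\<phi> x - v s) \<le> e" "0 \<le> e"
    and tot: "\<bar>measure N (space N) - measure N0 (space N0)\<bar> \<le> \<eta>"
    and part: "\<And>s. s \<in> S \<Longrightarrow> \<bar>(\<integral>x. f s x \<partial>N) - (\<integral>x. f s x \<partial>N0)\<bar> \<le> \<eta>"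
  shows "norm ((\<integral>x. \<phi> x \<partial>N) - (\<integral>x. \<phi> x \<partial>N0)) \<le>
    e * (2 * measure N0 (space N0) + \<eta>) + B * (2 * real (card S) + 1) * \<eta>"
proof -
  interpret N: finite_measure N by (rule N)
  interpret N0: finite_measure N0 by (rule N0)
  have sp: "space N0 = space N" using sets by (rule sets_eq_imp_space_eq)
  define \<sigma> where "\<sigma> x = (\<Sum>s\<in>S. f s x)" for x
  define \<psi> where "\<psi> x = (\<Sum>s\<in>S. f s x *\<^sub>R v s)" for x
  have f1: "f s x \<le> 1" if "s \<in> S" "x \<in> space N" for s x
    using member_le_sum[of s S "\<lambda>s. f s x"] S f0 that fsum[of x] by force
  have key: "norm (\<phi> x - \<psi> x) \<le> e + B * (1 - \<sigma> x)" if x: "x \<in> space N" for x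
  proof -
    have "\<phi> x - \<psi> x = (1 - \<sigma> x) *\<^sub>R \<phi> x + (\<Sum>s\<in>S. f s x *\<^sub>R (\<phi> x - v s))"
      by (simp add: \<psi>_def \<sigma>_def scaleR_diff_right sum_subtractf scaleR_diff_left scaleR_sum_left)
    also have "norm \<dots> \<le> (1 - \<sigma> x) * norm (\<phi> x) + (\<Sum>s\<in>S. f s x * e)"
    proof (intro norm_triangle_le add_mono)
      show "norm ((1 - \<sigma> x) *\<^sub>R \<phi> x) \<le> (1 - \<sigma> x) * norm (\<phi> x)"
        using fsum[OF x] by (simp add: \<sigma>_def)
      show "norm (\<Sum>s\<in>S. f s x *\<^sub>R (\<phi> x - v s)) \<le> (\<Sum>s\<in>S. f s x * e)"
      proof (rule sum_norm_le)
        fix s assume s: "s \<in> S"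
        show "norm (f s x *\<^sub>R (\<phi> x - v s)) \<le> f s x * e"
          using e(1)[OF s x] f0[OF s x] by (cases "f s x = 0") (auto intro!: mult_left_mono)
      qed
    qed
    also have "\<dots> \<le> (1 - \<sigma> x) * B + 1 * e"
      unfolding sum_distrib_right[symmetric] using B(1)[OF x] fsum[OF x] e(2)
      by (intro add_mono mult_left_mono mult_right_mono) (auto simp: \<sigma>_def)
    finally show ?thesis by (simp add: mult.commute)
  qed
  have bound: "norm ((\<integral>x. \<phi> x \<partial>P) - (\<Sum>s\<in>S. (\<integral>x. f s x \<partial>P) *\<^sub>R v s)) \<le>
      e * measure P (space P) + B * (measure P (space P) - (\<Sum>s\<in>S. \<integral>x. f s x \<partial>P))"
    and fi: "\<And>s. s \<in> S \<Longrightarrow> integrable P (f s)"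
    if P: "finite_measure P" "sets P = sets N" for P
  proof -
    interpret P: finite_measure P by (rule P)
    have spP: "space P = space N" using P(2) by (rule sets_eq_imp_space_eq)
    have "f s \<in> borel_measurable P" if "s \<in> S" for s
      using f[OF that] measurable_cong_sets[OF P(2) refl] by blast
    then show fi: "integrable P (f s)" if "s \<in> S" for s
      using that f0 f1 spP by (intro P.integrable_const_bound[of _ 1] AE_I2) auto
    have "\<phi> \<in> borel_measurable P" using \<phi> measurable_cong_sets[OF P(2) refl] by blast
    then have \<phi>i: "integrable P \<phi>"
      using B(1) spP by (intro P.integrable_const_bound[of _ B] AE_I2) auto
    have \<psi>i: "integrable P \<psi>" unfolding \<psi>_def using fi by (intro Bochner_Integration.integrable_sum) auto
    have \<sigma>i: "integrable P \<sigma>" unfolding \<sigma>_def using fi by (intro Bochner_Integration.integrable_sum) auto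
    have \<psi>int: "(\<integral>x. \<psi> x \<partial>P) = (\<Sum>s\<in>S. (\<integral>x. f s x \<partial>P) *\<^sub>R v s)"
      unfolding \<psi>_def using fi by (subst Bochner_Integration.integral_sum) auto
    have \<sigma>int: "(\<integral>x. \<sigma> x \<partial>P) = (\<Sum>s\<in>S. \<integral>x. f s x \<partial>P)"
      unfolding \<sigma>_def using fi by (subst Bochner_Integration.integral_sum) auto
    have "norm ((\<integral>x. \<phi> x \<partial>P) - (\<integral>x. \<psi> x \<partial>P)) = norm (\<integral>x. \<phi> x - \<psi> x \<partial>P)"
      using \<phi>i \<psi>i by simp
    also have "\<dots> \<le> (\<integral>x. norm (\<phi> x - \<psi> x) \<partial>P)" by (rule integral_norm_bound)
    also have "\<dots> \<le> (\<integral>x. e + B * (1 - \<sigma> x) \<partial>P)"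
      using \<phi>i \<psi>i \<sigma>i key spP by (intro integral_mono) auto
    also have "\<dots> = e * measure P (space P) + B * (measure P (space P) - (\<integral>x. \<sigma> x \<partial>P))"
      using \<sigma>i by (simp add: mult.commute)
    finally show "norm ((\<integral>x. \<phi> x \<partial>P) - (\<Sum>s\<in>S. (\<integral>x. f s x \<partial>P) *\<^sub>R v s)) \<le>
      e * measure P (space P) + B * (measure P (space P) - (\<Sum>s\<in>S. \<integral>x. f s x \<partial>P))"
      unfolding \<psi>int \<sigma>int .
  qed
  define T where "T = measure N (space N)"
  define T0 where "T0 = measure N0 (space N0)"
  define a where "a s = (\<integral>x. f s x \<partial>N)" for s
  define b where "b s = (\<integral>x. f s x \<partial>N0)" for s
  define k where "k = real (card S)"
  have b: "(\<Sum>s\<in>S. b s) = T0"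
  proof -
    have "(\<Sum>s\<in>S. b s) = (\<integral>x. \<sigma> x \<partial>N0)"
      unfolding \<sigma>_def b_def using fi[OF N0 sets] by (subst Bochner_Integration.integral_sum) auto
    also have "\<dots> = (\<integral>x. 1 \<partial>N0)"
    proof (rule integral_cong_AE)
      show "\<sigma> \<in> borel_measurable N0"
        unfolding \<sigma>_def using fi[OF N0 sets] by (intro borel_measurable_sum) auto
      show "AE x in N0. \<sigma> x = 1" using K by eventually_elim (simp add: \<sigma>_def fsum1)
    qed simp
    finally show ?thesis by (simp add: T0_def)
  qed
  have ab: "\<bar>a s - b s\<bar> \<le> \<eta>" if "s \<in> S" for s using part[OF that] by (simp add: a_def b_def)
  have absum: "(\<Sum>s\<in>S. \<bar>a s - b s\<bar>) \<le> k * \<eta>"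
    using sum_bounded_above[of S "\<lambda>s. \<bar>a s - b s\<bar>" \<eta>] ab by (simp add: k_def)
  have "T - (\<Sum>s\<in>S. a s) = (T - T0) - (\<Sum>s\<in>S. a s - b s)" by (simp add: sum_subtractf b)
  also have "\<dots> \<le> \<eta> + k * \<eta>"
    using tot absum sum_abs[of "\<lambda>s. a s - b s" S] unfolding T_def[symmetric] T0_def[symmetric] by linarith
  finally have rest: "T - (\<Sum>s\<in>S. a s) \<le> \<eta> + k * \<eta>" .
  have mid: "norm ((\<Sum>s\<in>S. a s *\<^sub>R v s) - (\<Sum>s\<in>S. b s *\<^sub>R v s)) \<le> B * (k * \<eta>)"
  proof -
    have "norm ((\<Sum>s\<in>S. a s *\<^sub>R v s) - (\<Sum>s\<in>S. b s *\<^sub>R v s)) = norm (\<Sum>s\<in>S. (a s - b s) *\<^sub>R v s)"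
      by (simp add: sum_subtractf scaleR_diff_left)
    also have "\<dots> \<le> (\<Sum>s\<in>S. \<bar>a s - b s\<bar> * B)"
      by (rule sum_norm_le) (auto intro!: mult_left_mono B)
    also have "\<dots> \<le> (k * \<eta>) * B" unfolding sum_distrib_right[symmetric] 
      using absum B(3) by (intro mult_right_mono) auto
    finally show ?thesis by (simp add: mult.commute)
  qed
  have 1: "norm ((\<integral>x. \<phi> x \<partial>N) - (\<Sum>s\<in>S. a s *\<^sub>R v s)) \<le> e * T + B * (\<eta> + k * \<eta>)"
    using bound[OF N refl] mult_left_mono[OF rest B(3)]
    unfolding T_def[symmetric] a_def[symmetric] by linarith
  have 2: "norm ((\<integral>x. \<phi> x \<partial>N0) - (\<Sum>s\<in>S. b s *\<^sub>R v s)) \<le> e * T0"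
    using bound[OF N0 sets] unfolding T0_def[symmetric] b_def[symmetric] b by simp
  have 3: "e * T \<le> e * (T0 + \<eta>)"
    using tot e(2) unfolding T_def[symmetric] T0_def[symmetric] by (intro mult_left_mono) auto
  have "(\<integral>x. \<phi> x \<partial>N) - (\<integral>x. \<phi> x \<partial>N0) =
     ((\<integral>x. \<phi> x \<partial>N) - (\<Sum>s\<in>S. a s *\<^sub>R v s)) + ((\<Sum>s\<in>S. a s *\<^sub>R v s) - (\<Sum>s\<in>S. b s *\<^sub>R v s))
     - ((\<integral>x. \<phi> x \<partial>N0) - (\<Sum>s\<in>S. b s *\<^sub>R v s))" by simp
  also have "norm \<dots> \<le> (e * T + B * (\<eta> + k * \<eta>)) + B * (k * \<eta>) + e * T0"
    by (intro norm_triangle_le_diff add_mono norm_triangle_le 1 2 mid)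
  also have "\<dots> \<le> e * (T0 + \<eta>) + B * (\<eta> + k * \<eta>) + B * (k * \<eta>) + e * T0" using 3 by simp
  also have "\<dots> = e * (2 * T0 + \<eta>) + B * (2 * k + 1) * \<eta>" by (simp add: algebra_simps)
  finally show ?thesis by (simp add: T0_def k_def)
qed

text \<open>
  The oscillation \<open>e\<close> has to be fixed before the number \<open>k\<close> of functions in the partition is known,
  and the tolerance \<open>\<eta>\<close> after it.
\<close>

lemma choose_error_bounds:
  fixes T y :: real
  assumes "0 \<le> T" "0 < y"
  obtains e where "0 < e"
    "\<And>B k. 0 \<le> B \<Longrightarrow> 0 \<le> k \<Longrightarrow> \<exists>\<eta>>0. e * (2 * T + \<eta>) + B * (2 * k + 1) * \<eta> \<le> (y::real)"
proof
  define e where "e = y / (2 * (2 * T + 1))"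
  show "0 < y / (2 * (2 * T + 1))" using assms by simp
  fix B k :: real assume B: "0 \<le> B" "0 \<le> k"
  define \<eta> where "\<eta> = min 1 (y / (2 * (B * (2 * k + 1) + 1)))"
  have P: "0 \<le> B * (2 * k + 1)" using B by simp
  have \<eta>: "\<eta> > 0" "\<eta> \<le> 1" "\<eta> \<le> y / (2 * (B * (2 * k + 1) + 1))"
    using assms P by (auto simp: \<eta>_def)
  have "e * (2 * T + \<eta>) \<le> e * (2 * T + 1)"
    using \<eta> assms by (intro mult_left_mono) (auto simp: e_def)
  also have "\<dots> = y / 2" using assms by (simp add: e_def field_simps)
  finally have 1: "e * (2 * T + \<eta>) \<le> y / 2" .
  have "B * (2 * k + 1) * \<eta> \<le> (B * (2 * k + 1) + 1) * (y / (2 * (B * (2 * k + 1) + 1)))"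
    using \<eta> P by (intro mult_mono) auto
  also have "\<dots> = y / 2" using P by (simp add: field_simps)
  finally show "\<exists>\<eta>>0. y / (2 * (2 * T + 1)) * (2 * T + \<eta>) + B * (2 * k + 1) * \<eta> \<le> y"
    using 1 \<eta> unfolding e_def by (intro exI[of _ \<eta>]) linarith
qed

section \<open>The bounded Lipschitz distance, uniformly over the group\<close>

text \<open>
  A group acting on a metric space by bijections that preserve \<open>zero_algebra\<close>; they need not be
  continuous.
\<close>

locale zero_algebra_action = Metric_space M d
  for M :: "'a set" and d :: "'a \<Rightarrow> 'a \<Rightarrow> real" +
  fixes G :: "('g, 'b) monoid_scheme" and h :: "'g \<Rightarrow> 'a \<Rightarrow> 'a"
  assumes act: "group_action G M h"
    and image_zero_algebra:
      "\<And>g A. g \<in> carrier G \<Longrightarrow> A \<in> zero_algebra mtopology \<Longrightarrow> h g ` A \<in> zero_algebra mtopology"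
begin

abbreviation Q :: "'a measure set" where
  "Q \<equiv> Q_tau_plus mtopology G h"

lemma one_carrier: "\<one>\<^bsub>G\<^esub> \<in> carrier G"
proof -
  interpret group_action G M h by (rule act)
  show ?thesis using group_hom group_hom.axioms(1) group.is_monoid monoid.one_closed by blast
qed

lemma carrier_nonempty: "carrier G \<noteq> {}"
  using one_carrier by blast

lemma act_measurable:
  assumes g: "g \<in> carrier G" and m: "space m = M" "sets m = zero_sigma_algebra mtopology"
  shows "h g \<in> measurable m m"
proof -
  interpret group_action G M h by (rule act)
  interpret group G using group_hom group_hom.axioms(1) by blast
  let ?h' = "h (inv\<^bsub>G\<^esub> g)"
  have g': "inv\<^bsub>G\<^esub> g \<in> carrier G" using g by simp
  have hM: "h g x \<in> M" "?h' x \<in> M" if "x \<in> M" for x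
    using element_image[OF g that refl] element_image[OF g' that refl] by auto
  have inverse: "?h' (h g x) = x" "h g (?h' x) = x" if "x \<in> M" for x
    using orbit_sym_aux[OF g that refl] orbit_sym_aux[OF g' that refl] g by auto
  show ?thesis
  proof (rule measurable_sigma_sets[where \<Omega> = M and A = "{C. closedin mtopology C}"])
    show "sets m = sigma_sets M {C. closedin mtopology C}"
      using m zero_sigma_algebra_closedin by simp
    show "{C. closedin mtopology C} \<subseteq> Pow M" using closedin_subset by fastforce
    show "h g \<in> space m \<rightarrow> M" using hM m by auto
    fix C assume "C \<in> {C. closedin mtopology C}"
    then have C: "closedin mtopology C" "C \<subseteq> M" using closedin_subset by fastforce+
    have "h g -` C \<inter> space m = ?h' ` C"
    proof (intro equalityI subsetI)
      fix x assume "x \<in> h g -` C \<inter> space m"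
      then have "h g x \<in> C" "x = ?h' (h g x)" using inverse m by auto
      then show "x \<in> ?h' ` C" by (rule rev_image_eqI)
    next
      fix x assume "x \<in> ?h' ` C"
      then show "x \<in> h g -` C \<inter> space m" using inverse hM C m by auto
    qed
    also have "\<dots> \<in> sets m"
      using image_zero_algebra[OF g'] closedin_zero_cozero[OF C(1)] zero_cozero_sets_subset_zero_algebra
        zero_algebra_subset_zero_sigma_algebra m by blast
    finally show "h g -` C \<inter> space m \<in> sets m" .
  qed
qed

lemma Q_D:
  assumes "m \<in> Q"
  shows "tau_smooth_measure mtopology m" "quasi_invariant G h m"
    "space m = M" "sets m = zero_sigma_algebra mtopology" "finite_measure m"
  using assms tau_smooth_measure_finite[of mtopology m] tau_smooth_measureD(1,2)[of mtopology m]
  by (auto simp: Q_tau_plus_def)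

lemma translate_props:
  assumes m: "m \<in> Q" and g: "g \<in> carrier G"
  shows "space (translate h g m) = M" "sets (translate h g m) = zero_sigma_algebra mtopology"
    "finite_measure (translate h g m)" "measure (translate h g m) M = measure m M"
proof -
  note mD = Q_D[OF m]
  have hm: "h g \<in> measurable m m" by (rule act_measurable[OF g mD(3,4)])
  show "space (translate h g m) = M" "sets (translate h g m) = zero_sigma_algebra mtopology"
    using mD by (simp_all add: translate_def)
  show "finite_measure (translate h g m)"
    unfolding translate_def by (rule finite_measure.finite_measure_distr[OF mD(5) hm])
  have "h g -` M \<inter> space m = space m" using measurable_space[OF hm] mD(3) by auto
  then show "measure (translate h g m) M = measure m M"
    unfolding translate_def using mD(3) by (subst measure_distr[OF hm]) auto
qed

lemma translate_one:
  assumes m: "m \<in> Q"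
  shows "translate h \<one>\<^bsub>G\<^esub> m = m"
proof -
  interpret group_action G M h by (rule act)
  have "h \<one>\<^bsub>G\<^esub> x = x" if "x \<in> space m" for x
    using id_eq_one that Q_D(3)[OF m] by (metis restrict_apply')
  then have "distr m m (h \<one>\<^bsub>G\<^esub>) = distr m m (\<lambda>x. x)" by (intro distr_cong) auto
  then show ?thesis by (simp add: translate_def)
qed

text \<open>
  Quasi-invariance enters here and only here: all translates of \<open>m\<close> are concentrated on the same
  compact set.
\<close>

lemma translate_AE_msupport:
  assumes m: "m \<in> Q" and g: "g \<in> carrier G"
  shows "AE x in translate h g m. x \<in> msupport m"
proof -
  have K: "AE x in m. x \<in> msupport m" by (rule tau_smooth_AE_msupport[OF Q_D(1)[OF m]])
  have "absolutely_continuous m (translate h g m)"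
    using Q_D(2)[OF m] g by (simp add: quasi_invariant_def equivalent_measures_def)
  moreover have "sets (translate h g m) = sets m" by (simp add: translate_def)
  ultimately show ?thesis using absolutely_continuous_AE[of "translate h g m" m] K by blast
qed

lemma cont_fun_translate_measurable:
  fixes f :: "'a \<Rightarrow> 'f::real_normed_field"
  assumes "f \<in> cont_fun mtopology" "m \<in> Q" "g \<in> carrier G"
  shows "f \<in> borel_measurable (translate h g m)"
  using cont_fun_measurable[OF assms(1)] translate_props[OF assms(2,3)] by blast

lemma integrable_translate:
  fixes f :: "'a \<Rightarrow> 'f::{real_normed_field, banach, second_countable_topology}"
  assumes f: "f \<in> cont_fun mtopology" "\<And>x. x \<in> M \<Longrightarrow> norm (f x) \<le> B"
    and m: "m \<in> Q" and g: "g \<in> carrier G"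
  shows "integrable (translate h g m) f"
proof -
  note t = translate_props[OF m g]
  interpret finite_measure "translate h g m" by (rule t(3))
  show ?thesis
    using f t(1) cont_fun_translate_measurable[OF f(1) m g]
    by (intro integrable_const_bound[of _ B] AE_I2) auto
qed

lemma norm_integral_translate_le:
  fixes f :: "'a \<Rightarrow> 'f::{real_normed_field, banach, second_countable_topology}"
  assumes f: "f \<in> cont_fun mtopology" "\<And>x. x \<in> M \<Longrightarrow> norm (f x) \<le> B"
    and m: "m \<in> Q" and g: "g \<in> carrier G"
  shows "norm (\<integral>x. f x \<partial>translate h g m) \<le> B * measure m M"
proof -
  note t = translate_props[OF m g]
  interpret finite_measure "translate h g m" by (rule t(3))
  have i: "integrable (translate h g m) f" by (rule integrable_translate[OF f m g])
  have "norm (\<integral>x. f x \<partial>translate h g m) \<le> (\<integral>x. norm (f x) \<partial>translate h g m)"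
    by (rule integral_norm_bound)
  also have "\<dots> \<le> (\<integral>x. B \<partial>translate h g m)"
    using i f(2) t(1) by (intro integral_mono) auto
  finally show ?thesis using t by (simp add: mult.commute)
qed

lemma norm_integral_translate_diff_le:
  fixes f :: "'a \<Rightarrow> 'f::{real_normed_field, banach, second_countable_topology}"
  assumes "f \<in> cont_fun mtopology" "\<And>x. x \<in> M \<Longrightarrow> norm (f x) \<le> B"
    and "m \<in> Q" "n \<in> Q" "g \<in> carrier G"
  shows "norm ((\<integral>x. f x \<partial>translate h g m) - (\<integral>x. f x \<partial>translate h g n)) \<le> B * measure m M + B * measure n M"
  using norm_integral_translate_le[OF assms(1,2,3,5)] norm_integral_translate_le[OF assms(1,2,4,5)]
  by (meson add_mono norm_triangle_le_diff)

text \<open>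
  The bounded Lipschitz distance of the translates, uniformly in the group element. The supremum is
  over a bounded set for \<open>m\<close> and \<open>n\<close> in \<open>Q\<close>; for other arguments its value is unspecified.
\<close>

definition bl_dist :: "'a measure \<Rightarrow> 'a measure \<Rightarrow> real" where
  "bl_dist m n = (SUP (g, \<phi>)\<in>carrier G \<times> BL.
     \<bar>(\<integral>x. \<phi> x \<partial>translate h g m) - (\<integral>x. \<phi> x \<partial>translate h g n)\<bar>)"

lemma bl_dist_upper:
  assumes m: "m \<in> Q" "n \<in> Q" and g: "g \<in> carrier G" and \<phi>: "\<phi> \<in> BL"
  shows "\<bar>(\<integral>x. \<phi> x \<partial>translate h g m) - (\<integral>x. \<phi> x \<partial>translate h g n)\<bar> \<le> bl_dist m n"
proof -
  have "bdd_above ((\<lambda>(g, \<phi>). \<bar>(\<integral>x. \<phi> x \<partial>translate h g m) - (\<integral>x. \<phi> x \<partial>translate h g n)\<bar>) ` (carrier G \<times> BL))"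
  proof (rule bdd_aboveI2, clarify)
    fix g \<phi> assume "g \<in> carrier G" and "\<phi> \<in> BL"
    then show "\<bar>(\<integral>x. \<phi> x \<partial>translate h g m) - (\<integral>x. \<phi> x \<partial>translate h g n)\<bar> \<le> 1 * measure m M + 1 * measure n M"
      using norm_integral_translate_diff_le[of \<phi> 1 m n g] m BL_bcont_fun[of \<phi>]
      by (auto simp: BL_def bcont_fun_def)
  qed
  then show ?thesis unfolding bl_dist_def using g \<phi>
    by (intro cSUP_upper2[where x = "(g, \<phi>)"]) auto
qed

lemma bl_dist_least:
  assumes "\<And>g \<phi>. g \<in> carrier G \<Longrightarrow> \<phi> \<in> BL \<Longrightarrow>
    \<bar>(\<integral>x. \<phi> x \<partial>translate h g m) - (\<integral>x. \<phi> x \<partial>translate h g n)\<bar> \<le> B"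
  shows "bl_dist m n \<le> B"
  unfolding bl_dist_def using assms carrier_nonempty const_BL
  by (intro cSUP_least) auto

text \<open>
  The indicator of a closed set \<open>C\<close> is the limit of the Lipschitz functions
  \<open>1 - min 1 (k * cdist C x)\<close>, and the closed sets are an intersection-stable generator.
\<close>

lemma measure_eq_if_BL_integrals_eq:
  assumes m: "m \<in> Q" and n: "n \<in> Q"
    and eq: "\<And>\<phi>. \<phi> \<in> BL \<Longrightarrow> (\<integral>x. \<phi> x \<partial>m) = (\<integral>x. \<phi> x \<partial>n)"
  shows "m = n"
proof (rule measure_eqI_generator_eq[where \<Omega> = M and E = "{C. closedin mtopology C}" and A = "\<lambda>_. M"])
  note mD = Q_D[OF m] and nD = Q_D[OF n]
  show "Int_stable {C. closedin mtopology C}" by (auto simp: Int_stable_def closedin_Int)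
  show "{C. closedin mtopology C} \<subseteq> Pow M" using closedin_subset by fastforce
  show "sets m = sigma_sets M {C. closedin mtopology C}" "sets n = sigma_sets M {C. closedin mtopology C}"
    using mD nD zero_sigma_algebra_closedin by auto
  show "range (\<lambda>_::nat. M) \<subseteq> {C. closedin mtopology C}"
    using closedin_topspace[of mtopology] by auto
  show "emeasure m M \<noteq> \<infinity>" for i :: nat using finite_measure.emeasure_finite[OF mD(5)] by simp
  fix C assume "C \<in> {C. closedin mtopology C}"
  then have C: "closedin mtopology C" and CM: "C \<subseteq> M" using closedin_subset by fastforce+
  define w where "w k x = 1 - min 1 (real k * cdist C x)" for k x
  have wlim: "(\<lambda>k. w k x) \<longlonglongrightarrow> indicator C x" if x: "x \<in> M" for x
  proof (cases "x \<in> C")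
    case True
    then show ?thesis using cdist_eq_0[OF x True] by (simp add: w_def)
  next
    case False
    then have pos: "cdist C x > 0" using cdist_pos[OF C x] by simp
    then obtain N where N: "inverse (cdist C x) < real N" using reals_Archimedean2 by blast
    have "w k x = 0" if "k \<ge> N" for k
    proof -
      have "inverse (cdist C x) < real k" using N that by linarith
      then have "1 < real k * cdist C x" using pos by (simp add: field_simps)
      then show ?thesis by (simp add: w_def)
    qed
    then have "\<forall>\<^sub>F k in sequentially. w k x = indicator C x"
      using False by (intro eventually_sequentiallyI[of N]) auto
    then show ?thesis by (rule tendsto_eventually)
  qed
  have cl: "cdist C \<in> BL" by (rule cdist_BL[OF CM])
  have wBL: "(\<lambda>x. inverse (real k + 1) * w k x) \<in> BL" for k
  proof -
    have w01: "0 \<le> w k x" "w k x \<le> 1" for x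
      using cdist_nonneg[of C x] by (auto simp: w_def)
    have wL: "\<bar>w k x - w k y\<bar> \<le> (real k + 1) * d x y" if "x \<in> M" "y \<in> M" for x y
    proof -
      have "\<bar>w k x - w k y\<bar> \<le> \<bar>real k * cdist C x - real k * cdist C y\<bar>" by (auto simp: w_def)
      also have "\<dots> = real k * \<bar>cdist C x - cdist C y\<bar>" by (simp add: right_diff_distrib[symmetric] abs_mult)
      also have "\<dots> \<le> (real k + 1) * d x y"
        using cl that by (intro mult_mono) (auto simp: BL_def)
      finally show ?thesis .
    qed
    show ?thesis unfolding BL_def
    proof (intro CollectI conjI ballI)
      fix x
      show "\<bar>inverse (real k + 1) * w k x\<bar> \<le> 1"
        using w01[of x] by (simp add: abs_mult field_simps)
      fix y assume "x \<in> M" "y \<in> M"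
      have "\<bar>inverse (real k + 1) * w k x - inverse (real k + 1) * w k y\<bar> = inverse (real k + 1) * \<bar>w k x - w k y\<bar>"
        by (simp add: right_diff_distrib[symmetric] abs_mult)
      also have "\<dots> \<le> d x y" using wL[OF \<open>x \<in> M\<close> \<open>y \<in> M\<close>] by (simp add: field_simps)
      finally show "\<bar>inverse (real k + 1) * w k x - inverse (real k + 1) * w k y\<bar> \<le> d x y" .
    qed
  qed
  have weq: "(\<integral>x. w k x \<partial>m) = (\<integral>x. w k x \<partial>n)" for k
    using eq[OF wBL[of k]] by simp
  have lim: "(\<lambda>k. \<integral>x. w k x \<partial>p) \<longlonglongrightarrow> measure p C" if p: "p \<in> Q" for p
  proof -
    note pD = Q_D[OF p]
    interpret finite_measure p by (rule pD(5))
    have [measurable]: "cdist C \<in> borel_measurable p"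
      using BL_bcont_fun[OF cl] cont_fun_measurable[OF _ pD(3,4)] by (auto simp: bcont_fun_def)
    have Cs: "C \<in> sets p" by (rule closedin_sets[OF C pD(4)])
    have "(\<lambda>k. \<integral>x. w k x \<partial>p) \<longlonglongrightarrow> (\<integral>x. indicator C x \<partial>p)"
    proof (rule integral_dominated_convergence[of _ _ _ "\<lambda>_. 1"])
      show "w k \<in> borel_measurable p" for k unfolding w_def by measurable
      show "AE x in p. (\<lambda>k. w k x) \<longlonglongrightarrow> indicator C x" using wlim pD(3) by (intro AE_I2) auto
      show "AE x in p. norm (w k x) \<le> 1" for k
        using cdist_nonneg[of C] by (intro AE_I2) (auto simp: w_def)
    qed (use Cs in auto)
    then show ?thesis using Cs by simp
  qed
  have "measure m C = measure n C"
    using LIMSEQ_unique[OF lim[OF m]] lim[OF n] weq by simp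
  then show "emeasure m C = emeasure n C"
    using finite_measure.emeasure_eq_measure[OF mD(5)] finite_measure.emeasure_eq_measure[OF nD(5)] by simp
qed (use Q_D[OF m] in auto)

lemma bl_dist_nonneg: "m \<in> Q \<Longrightarrow> n \<in> Q \<Longrightarrow> 0 \<le> bl_dist m n"
  using bl_dist_upper[OF _ _ one_carrier const_BL, of m n] by linarith

text \<open>
  The absolute value only serves to make the distance non-negative for arguments outside \<open>Q\<close> too.
\<close>

lemma Metric_space_bl_dist: "Metric_space Q (\<lambda>m n. \<bar>bl_dist m n\<bar>)"
proof
  show "0 \<le> \<bar>bl_dist m n\<bar>" for m n by simp
  show "\<bar>bl_dist m n\<bar> = \<bar>bl_dist n m\<bar>" for m n
    unfolding bl_dist_def by (simp add: abs_minus_commute)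
  show "\<bar>bl_dist m n\<bar> = 0 \<longleftrightarrow> m = n" if mn: "m \<in> Q" "n \<in> Q" for m n
  proof
    assume 0: "\<bar>bl_dist m n\<bar> = 0"
    show "m = n"
    proof (rule measure_eq_if_BL_integrals_eq[OF mn])
      fix \<phi> assume "\<phi> \<in> BL"
      from bl_dist_upper[OF mn one_carrier this] show "(\<integral>x. \<phi> x \<partial>m) = (\<integral>x. \<phi> x \<partial>n)"
        using 0 translate_one mn by simp
    qed
  next
    assume "m = n"
    then have "bl_dist m n \<le> 0" by (intro bl_dist_least) auto
    then show "\<bar>bl_dist m n\<bar> = 0" using bl_dist_nonneg[OF mn] by simp
  qed
  show "\<bar>bl_dist l n\<bar> \<le> \<bar>bl_dist l m\<bar> + \<bar>bl_dist m n\<bar>" if "l \<in> Q" "m \<in> Q" "n \<in> Q" for l m n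
  proof -
    have "bl_dist l n \<le> bl_dist l m + bl_dist m n"
    proof (rule bl_dist_least)
      fix g \<phi> assume g: "g \<in> carrier G" "\<phi> \<in> BL"
      show "\<bar>(\<integral>x. \<phi> x \<partial>translate h g l) - (\<integral>x. \<phi> x \<partial>translate h g n)\<bar> \<le> bl_dist l m + bl_dist m n"
        using bl_dist_upper[OF that(1,2) g] bl_dist_upper[OF that(2,3) g] by linarith
    qed
    then show ?thesis using bl_dist_nonneg that by simp
  qed
qed

text \<open>
  The estimate of \<open>norm_integral_diff_le_partition\<close> for translates. Its right-hand side does not
  depend on \<open>g\<close>, because one partition of unity on the support of \<open>m0\<close> serves all translates of \<open>m0\<close>.
\<close>

lemma partition_estimate:
  fixes \<phi> :: "'a \<Rightarrow> 'f::{real_normed_field, banach, second_countable_topology}"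
  assumes m0: "m0 \<in> Q" and n: "n \<in> Q" and g: "g \<in> carrier G"
    and S: "finite S" "S \<subseteq> msupport m0"
    and f: "\<And>s. s \<in> S \<Longrightarrow> f s \<in> cont_fun mtopology"
    and f0: "\<And>s x. s \<in> S \<Longrightarrow> x \<in> M \<Longrightarrow> 0 \<le> f s x"
    and fr: "\<And>s x. s \<in> S \<Longrightarrow> x \<in> M \<Longrightarrow> 0 < f s x \<Longrightarrow> d x s < r"
    and fsum: "\<And>x. x \<in> M \<Longrightarrow> (\<Sum>s\<in>S. f s x) \<le> 1"
    and fsum1: "\<And>x. x \<in> msupport m0 \<Longrightarrow> (\<Sum>s\<in>S. f s x) = 1"
    and \<phi>: "\<phi> \<in> cont_fun mtopology" "\<And>x. x \<in> M \<Longrightarrow> norm (\<phi> x) \<le> B" "0 \<le> B"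
    and e: "\<And>x s. x \<in> M \<Longrightarrow> s \<in> msupport m0 \<Longrightarrow> d x s < r \<Longrightarrow> norm (\<phi> x - \<phi> s) \<le> e" "0 \<le> e"
    and tot: "\<bar>(\<integral>x. 1 \<partial>translate h g n) - (\<integral>x. 1 \<partial>translate h g m0)\<bar> \<le> \<eta>"
    and part: "\<And>s. s \<in> S \<Longrightarrow>
      \<bar>(\<integral>x. f s x \<partial>translate h g n) - (\<integral>x. f s x \<partial>translate h g m0)\<bar> \<le> \<eta>"
  shows "norm ((\<integral>x. \<phi> x \<partial>translate h g n) - (\<integral>x. \<phi> x \<partial>translate h g m0)) \<le>
    e * (2 * measure m0 M + \<eta>) + B * (2 * real (card S) + 1) * \<eta>"
proof -
  note t0 = translate_props[OF m0 g] and t = translate_props[OF n g]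
  have KM: "msupport m0 \<subseteq> M" by (auto simp: msupport_def)
  have "norm ((\<integral>x. \<phi> x \<partial>translate h g n) - (\<integral>x. \<phi> x \<partial>translate h g m0)) \<le>
    e * (2 * measure (translate h g m0) (space (translate h g m0)) + \<eta>) + B * (2 * real (card S) + 1) * \<eta>"
  proof (rule norm_integral_diff_le_partition[where f = f and v = \<phi> and K = "msupport m0"])
    show "f s \<in> borel_measurable (translate h g n)" if "s \<in> S" for s
      by (rule cont_fun_translate_measurable[OF f[OF that] n g])
    show "\<phi> \<in> borel_measurable (translate h g n)"
      by (rule cont_fun_translate_measurable[OF \<phi>(1) n g])
    show "norm (\<phi> s) \<le> B" if "s \<in> S" for s using \<phi>(2) that S KM by blast
    show "norm (\<phi> x - \<phi> s) \<le> e" if "s \<in> S" "x \<in> space (translate h g n)" "0 < f s x" for s x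
      using e(1)[of x s] fr[of s x] that t S by auto
    show "\<bar>measure (translate h g n) (space (translate h g n)) -
        measure (translate h g m0) (space (translate h g m0))\<bar> \<le> \<eta>"
      using tot by simp
  qed (use t t0 S f0 fsum fsum1 \<phi> e part translate_AE_msupport[OF m0 g] in auto)
  then show ?thesis using t0 by simp
qed

text \<open>
  Every subbasic \<open>\<tau>\<^sub>s\<close>-neighbourhood contains a \<open>bl_dist\<close>-ball.
\<close>

lemma bl_ball_subset_tau_s_nbhd:
  fixes f :: "'a \<Rightarrow> 'f::{real_normed_field, banach, second_countable_topology}"
  assumes m0: "m0 \<in> Q" and f: "f \<in> bcont_fun mtopology" and y: "0 < y"
  obtains \<rho> where "0 < \<rho>" "\<And>n. n \<in> Q \<Longrightarrow> bl_dist n m0 < \<rho> \<Longrightarrow>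
    (SUP g\<in>carrier G. norm ((\<integral>x. f x \<partial>translate h g n) - (\<integral>x. f x \<partial>translate h g m0))) < y"
proof -
  define K where "K = msupport m0"
  have K: "compactin mtopology K" unfolding K_def by (rule tau_smooth_compact_msupport[OF Q_D(1)[OF m0]])
  have fc: "f \<in> cont_fun mtopology" using f by (simp add: bcont_fun_def)
  obtain B where B: "0 < B" "\<And>x. x \<in> M \<Longrightarrow> norm (f x) \<le> B"
    using f by (auto simp: bcont_fun_def bounded_pos)
  obtain e where e: "0 < e"
    "\<And>B k. 0 \<le> B \<Longrightarrow> 0 \<le> k \<Longrightarrow> \<exists>\<eta>>0. e * (2 * measure m0 M + \<eta>) + B * (2 * k + 1) * \<eta> \<le> y / 2"
    using choose_error_bounds[of "measure m0 M" "y / 2"] y by auto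
  obtain r where r: "r > 0" "\<And>x s. x \<in> M \<Longrightarrow> s \<in> K \<Longrightarrow> d x s < r \<Longrightarrow> norm (f x - f s) \<le> e"
    using cont_fun_uniform_near_compact[OF fc K e(1)] by blast
  obtain S w c where w: "finite S" "S \<subseteq> K" "c > 0" "\<And>s. s \<in> S \<Longrightarrow> (\<lambda>x. c * w s x) \<in> BL"
    "\<And>s x. s \<in> S \<Longrightarrow> x \<in> M \<Longrightarrow> 0 \<le> w s x"
    "\<And>s x. s \<in> S \<Longrightarrow> x \<in> M \<Longrightarrow> 0 < w s x \<Longrightarrow> d x s < r"
    "\<And>x. x \<in> M \<Longrightarrow> (\<Sum>s\<in>S. w s x) \<le> 1"
    "\<And>x. x \<in> K \<Longrightarrow> (\<Sum>s\<in>S. w s x) = (1::real)"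
    by (rule Lipschitz_partition[OF K r(1)]) (rule that)
  obtain \<eta> where \<eta>: "\<eta> > 0"
    "e * (2 * measure m0 M + \<eta>) + B * (2 * real (card S) + 1) * \<eta> \<le> y / 2"
    using e(2)[of B "real (card S)"] B by auto
  have wc: "w s \<in> cont_fun mtopology" if "s \<in> S" for s
    by (rule BL_scaled_cont_fun[OF w(3) w(4)[OF that]])
  show thesis
  proof (rule that[of "min 1 c * \<eta>"])
    show "0 < min 1 c * \<eta>" using w(3) \<eta>(1) by simp
    fix n assume n: "n \<in> Q" and close: "bl_dist n m0 < min 1 c * \<eta>"
    have "norm ((\<integral>x. f x \<partial>translate h g n) - (\<integral>x. f x \<partial>translate h g m0)) \<le> y / 2"
      if g: "g \<in> carrier G" for g
    proof -
      have "norm ((\<integral>x. f x \<partial>translate h g n) - (\<integral>x. f x \<partial>translate h g m0)) \<le>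
        e * (2 * measure m0 M + \<eta>) + B * (2 * real (card S) + 1) * \<eta>"
      proof (rule partition_estimate[OF m0 n g w(1) w(2)[unfolded K_def] wc w(5) w(6) w(7) w(8)[unfolded K_def]
            fc B(2) less_imp_le[OF B(1)] r(2)[unfolded K_def] less_imp_le[OF e(1)]])
        have "min 1 c * \<eta> \<le> 1 * \<eta>" using \<eta> by (intro mult_right_mono) auto
        then show "\<bar>(\<integral>x. 1 \<partial>translate h g n) - (\<integral>x. 1 \<partial>translate h g m0)\<bar> \<le> \<eta>"
          using bl_dist_upper[OF n m0 g const_BL] close by linarith
        fix s assume s: "s \<in> S"
        have "c * \<bar>(\<integral>x. w s x \<partial>translate h g n) - (\<integral>x. w s x \<partial>translate h g m0)\<bar> =
          \<bar>(\<integral>x. c * w s x \<partial>translate h g n) - (\<integral>x. c * w s x \<partial>translate h g m0)\<bar>"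
          using w(3) by (simp add: right_diff_distrib[symmetric] abs_mult)
        also have "\<dots> \<le> bl_dist n m0" by (rule bl_dist_upper[OF n m0 g w(4)[OF s]])
        also have "\<dots> \<le> c * \<eta>" using close \<eta> mult_right_mono[of "min 1 c" c \<eta>] by linarith
        finally show "\<bar>(\<integral>x. w s x \<partial>translate h g n) - (\<integral>x. w s x \<partial>translate h g m0)\<bar> \<le> \<eta>"
          using w(3) by simp
      qed
      then show ?thesis using \<eta>(2) by linarith
    qed
    then have "(SUP g\<in>carrier G. norm ((\<integral>x. f x \<partial>translate h g n) - (\<integral>x. f x \<partial>translate h g m0))) \<le> y / 2"
      using carrier_nonempty by (intro cSUP_least) auto
    then show "(SUP g\<in>carrier G. norm ((\<integral>x. f x \<partial>translate h g n) - (\<integral>x. f x \<partial>translate h g m0))) < y"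
      using y by linarith
  qed
qed

lemma tau_s_nbhd_bound:
  fixes f :: "'a \<Rightarrow> 'f::{real_normed_field, banach, second_countable_topology}"
  assumes n: "n \<in> tau_s_nbhd mtopology G h m0 fs y" and m0: "m0 \<in> Q"
    and f: "f \<in> fs" "f \<in> bcont_fun mtopology" and g: "g \<in> carrier G"
  shows "norm ((\<integral>x. f x \<partial>translate h g n) - (\<integral>x. f x \<partial>translate h g m0)) \<le> y"
proof -
  have nQ: "n \<in> Q" using n by (simp add: tau_s_nbhd_def)
  have fc: "f \<in> cont_fun mtopology" using f by (simp add: bcont_fun_def)
  obtain B where B: "\<And>x. x \<in> M \<Longrightarrow> norm (f x) \<le> B"
    using f by (auto simp: bcont_fun_def bounded_iff)
  have "norm ((\<integral>x. f x \<partial>translate h g n) - (\<integral>x. f x \<partial>translate h g m0)) \<le>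
    (SUP g\<in>carrier G. norm ((\<integral>x. f x \<partial>translate h g n) - (\<integral>x. f x \<partial>translate h g m0)))"
    using norm_integral_translate_diff_le[OF fc B nQ m0] g
    by (intro cSUP_upper bdd_aboveI2[of _ _ "B * measure n M + B * measure m0 M"]) auto
  also have "\<dots> < y" using n f by (simp add: tau_s_nbhd_def)
  finally show ?thesis by simp
qed

text \<open>
  Conversely, the constant 1 and one finite partition of unity, viewed as functions into the scalar
  field, suffice to control all functions in \<open>BL\<close> at once.
\<close>

lemma tau_s_nbhd_subset_bl_ball:
  assumes m0: "m0 \<in> Q" and y: "0 < y"
  obtains fs :: "('a \<Rightarrow> 'f::{real_normed_field, banach, second_countable_topology}) set" and \<eta>
  where "finite fs" "fs \<subseteq> bcont_fun mtopology" "\<eta> > 0"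
    "\<And>n. n \<in> tau_s_nbhd mtopology G h m0 fs \<eta> \<Longrightarrow> bl_dist n m0 < y"
proof -
  define K where "K = msupport m0"
  have K: "compactin mtopology K" unfolding K_def by (rule tau_smooth_compact_msupport[OF Q_D(1)[OF m0]])
  have KM: "K \<subseteq> M" by (auto simp: K_def msupport_def)
  obtain e where e: "0 < e"
    "\<And>B k. 0 \<le> B \<Longrightarrow> 0 \<le> k \<Longrightarrow> \<exists>\<eta>>0. e * (2 * measure m0 M + \<eta>) + B * (2 * k + 1) * \<eta> \<le> y / 2"
    using choose_error_bounds[of "measure m0 M" "y / 2"] y by auto
  obtain S w c where w: "finite S" "S \<subseteq> K" "c > 0" "\<And>s. s \<in> S \<Longrightarrow> (\<lambda>x. c * w s x) \<in> BL"
    "\<And>s x. s \<in> S \<Longrightarrow> x \<in> M \<Longrightarrow> 0 \<le> w s x"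
    "\<And>s x. s \<in> S \<Longrightarrow> x \<in> M \<Longrightarrow> 0 < w s x \<Longrightarrow> d x s < e"
    "\<And>x. x \<in> M \<Longrightarrow> (\<Sum>s\<in>S. w s x) \<le> 1"
    "\<And>x. x \<in> K \<Longrightarrow> (\<Sum>s\<in>S. w s x) = (1::real)"
    by (rule Lipschitz_partition[OF K e(1)]) (rule that)
  obtain \<eta> where \<eta>: "\<eta> > 0"
    "e * (2 * measure m0 M + \<eta>) + 1 * (2 * real (card S) + 1) * \<eta> \<le> y / 2"
    using e(2)[of 1 "real (card S)"] by auto
  have wc: "w s \<in> cont_fun mtopology" if "s \<in> S" for s
    by (rule BL_scaled_cont_fun[OF w(3) w(4)[OF that]])
  have w1: "w s x \<le> 1" if "s \<in> S" "x \<in> M" for s x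
    using member_le_sum[of s S "\<lambda>s. w s x"] w(1) w(5) that w(7)[of x] by force
  define fs :: "('a \<Rightarrow> 'f) set" where "fs = insert (\<lambda>x. of_real 1) ((\<lambda>s x. of_real (w s x)) ` S)"
  have fs: "fs \<subseteq> bcont_fun mtopology"
  proof -
    have "(\<lambda>x. of_real (u x) :: 'f) \<in> bcont_fun mtopology"
      if u: "u \<in> cont_fun mtopology" and u01: "\<And>x. x \<in> M \<Longrightarrow> 0 \<le> u x \<and> u x \<le> 1" for u :: "'a \<Rightarrow> real"
    proof -
      have "continuous_map mtopology euclidean u" using u by (simp add: cont_fun_def)
      moreover have "continuous_map euclidean euclidean (of_real :: real \<Rightarrow> 'f)"
        by (simp add: continuous_on_of_real)
      ultimately have "continuous_map mtopology euclidean ((of_real :: real \<Rightarrow> 'f) \<circ> u)"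
        by (rule continuous_map_compose)
      then have "continuous_map mtopology euclidean (\<lambda>x. of_real (u x) :: 'f)" by (simp add: o_def)
      then show ?thesis using u01 by (auto simp: bcont_fun_def cont_fun_def bounded_iff intro!: exI[of _ 1])
    qed
    from this[of "\<lambda>_. 1"] this[OF wc] show ?thesis
      unfolding fs_def using w(5) w1 by (auto simp: cont_fun_def)
  qed
  show thesis
  proof (rule that[of fs \<eta>])
    show "finite fs" using w(1) by (simp add: fs_def)
    fix n assume nn: "n \<in> tau_s_nbhd mtopology G h m0 fs \<eta>"
    have n: "n \<in> Q" using nn by (simp add: tau_s_nbhd_def)
    have test: "\<bar>(\<integral>x. u x \<partial>translate h g n) - (\<integral>x. u x \<partial>translate h g m0)\<bar> \<le> \<eta>"
      if g: "g \<in> carrier G" and u: "(\<lambda>x. of_real (u x)) \<in> fs"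
        and uc: "u \<in> cont_fun mtopology" "\<And>x. x \<in> M \<Longrightarrow> norm (u x) \<le> 1" for g u
    proof -
      have "norm ((\<integral>x. of_real (u x) \<partial>translate h g n) - (\<integral>x. of_real (u x) \<partial>translate h g m0) :: 'f) \<le> \<eta>"
        using tau_s_nbhd_bound[OF nn m0 u _ g] fs u by blast
      moreover have "(\<integral>x. of_real (u x) \<partial>P) = (of_real (\<integral>x. u x \<partial>P) :: 'f)"
        if "integrable P u" for P :: "'a measure"
        using that by (intro integral_of_real) simp
      moreover have "integrable (translate h g n) u" "integrable (translate h g m0) u"
        using integrable_translate[OF uc n g] integrable_translate[OF uc m0 g] by auto
      ultimately show ?thesis by (metis norm_of_real of_real_diff)
    qed
    have "bl_dist n m0 \<le> y / 2"
    proof (rule bl_dist_least)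
      fix g \<phi> assume g: "g \<in> carrier G" and \<phi>: "\<phi> \<in> BL"
      have "norm ((\<integral>x. \<phi> x \<partial>translate h g n) - (\<integral>x. \<phi> x \<partial>translate h g m0)) \<le>
        e * (2 * measure m0 M + \<eta>) + 1 * (2 * real (card S) + 1) * \<eta>"
      proof (rule partition_estimate[OF m0 n g w(1) w(2)[unfolded K_def] wc w(5) w(6) w(7) w(8)[unfolded K_def]])
        show "\<phi> \<in> cont_fun mtopology" using BL_bcont_fun[OF \<phi>] by (simp add: bcont_fun_def)
        show "norm (\<phi> x) \<le> 1" if "x \<in> M" for x using \<phi> that by (simp add: BL_def)
        show "norm (\<phi> x - \<phi> s) \<le> e" if "x \<in> M" "s \<in> msupport m0" "d x s < e" for x s
          using \<phi> that KM unfolding BL_def K_def by fastforce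
        show "\<bar>(\<integral>x. 1 \<partial>translate h g n) - (\<integral>x. 1 \<partial>translate h g m0)\<bar> \<le> \<eta>"
          by (rule test[OF g]) (simp_all add: fs_def cont_fun_def)
        show "\<bar>(\<integral>x. w s x \<partial>translate h g n) - (\<integral>x. w s x \<partial>translate h g m0)\<bar> \<le> \<eta>" if "s \<in> S" for s
          by (rule test[OF g]) (use that wc w(5) w1 in \<open>simp_all add: fs_def\<close>)
      qed (use e in auto)
      then show "\<bar>(\<integral>x. \<phi> x \<partial>translate h g n) - (\<integral>x. \<phi> x \<partial>translate h g m0)\<bar> \<le> y / 2"
        using \<eta>(2) by simp
    qed
    then show "bl_dist n m0 < y" using y by linarith
  qed (use fs \<eta> in auto)
qed

section \<open>Metrizability\<close>

lemma metrizable_space_tau_s: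
  "metrizable_space
    (tau_s TYPE('f::{real_normed_field, banach, second_countable_topology}) mtopology G h)"
proof -
  interpret bl: Metric_space Q "\<lambda>m n. \<bar>bl_dist m n\<bar>" by (rule Metric_space_bl_dist)
  have ball: "n \<in> bl.mball m0 r \<longleftrightarrow> n \<in> Q \<and> bl_dist n m0 < r" if "m0 \<in> Q" for m0 n r
    using that bl_dist_nonneg[of n m0] bl.commute[of m0 n] by auto
  have "tau_s TYPE('f) mtopology G h = bl.mtopology"
    unfolding topology_eq openin_tau_s bl.openin_mtopology
  proof (intro allI conj_cong refl iffI ballI impI)
    fix U m0 assume UQ: "U \<subseteq> Q" and m0U: "m0 \<in> U"
      and tau: "\<forall>m0\<in>U. \<exists>fs y. finite fs \<and> fs \<subseteq> (bcont_fun mtopology :: ('a \<Rightarrow> 'f) set) \<and> y > 0 \<and>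
        tau_s_nbhd mtopology G h m0 fs y \<subseteq> U"
    have m0: "m0 \<in> Q" using UQ m0U by blast
    obtain fs :: "('a \<Rightarrow> 'f) set" and y where fs: "finite fs" "fs \<subseteq> bcont_fun mtopology" "y > 0"
      "tau_s_nbhd mtopology G h m0 fs y \<subseteq> U"
      using bspec[OF tau m0U] by (elim exE conjE) (rule that)
    define D where "D f n =
      (SUP g\<in>carrier G. norm ((\<integral>x. f x \<partial>translate h g n) - (\<integral>x. f x \<partial>translate h g m0)))"
      for f :: "'a \<Rightarrow> 'f" and n
    have "\<forall>f\<in>fs. \<exists>\<rho>>0. \<forall>n\<in>Q. bl_dist n m0 < \<rho> \<longrightarrow> D f n < y"
    proof
      fix f assume "f \<in> fs"
      then have f: "f \<in> bcont_fun mtopology" using fs(2) by blast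
      show "\<exists>\<rho>>0. \<forall>n\<in>Q. bl_dist n m0 < \<rho> \<longrightarrow> D f n < y"
        unfolding D_def by (rule bl_ball_subset_tau_s_nbhd[OF m0 f fs(3)]) blast
    qed
    from bchoice[OF this] obtain \<rho> where \<rho>: "\<And>f. f \<in> fs \<Longrightarrow> \<rho> f > 0"
      "\<And>f n. f \<in> fs \<Longrightarrow> n \<in> Q \<Longrightarrow> bl_dist n m0 < \<rho> f \<Longrightarrow> D f n < y"
      by blast
    define r where "r = Min (insert 1 (\<rho> ` fs))"
    have "r > 0" unfolding r_def using fs(1) \<rho>(1) by (subst Min_gr_iff) auto
    moreover have r: "r \<le> \<rho> f" if "f \<in> fs" for f unfolding r_def using fs(1) that by (intro Min_le) auto
    have "bl.mball m0 r \<subseteq> tau_s_nbhd mtopology G h m0 fs y"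
    proof
      fix n assume "n \<in> bl.mball m0 r"
      then have n: "n \<in> Q" "bl_dist n m0 < r" using ball[OF m0] by auto
      have "D f n < y" if "f \<in> fs" for f using \<rho>(2)[OF that n(1)] r[OF that] n(2) by linarith
      then show "n \<in> tau_s_nbhd mtopology G h m0 fs y" using n(1) by (simp add: tau_s_nbhd_def D_def)
    qed
    ultimately show "\<exists>r>0. bl.mball m0 r \<subseteq> U" using fs(4) by blast
  next
    fix U m0 assume UQ: "U \<subseteq> Q" and m0U: "m0 \<in> U"
      and op: "\<forall>x. x \<in> U \<longrightarrow> (\<exists>r>0. bl.mball x r \<subseteq> U)"
    have m0: "m0 \<in> Q" using UQ m0U by blast
    obtain r where r: "r > 0" "bl.mball m0 r \<subseteq> U" using op m0U by blast
    obtain fs :: "('a \<Rightarrow> 'f) set" and \<eta> where fs: "finite fs" "fs \<subseteq> bcont_fun mtopology" "\<eta> > 0"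
      "\<And>n. n \<in> tau_s_nbhd mtopology G h m0 fs \<eta> \<Longrightarrow> bl_dist n m0 < r"
      by (rule tau_s_nbhd_subset_bl_ball[OF m0 r(1)]) (rule that)
    have "tau_s_nbhd mtopology G h m0 fs \<eta> \<subseteq> bl.mball m0 r"
    proof
      fix n assume "n \<in> tau_s_nbhd mtopology G h m0 fs \<eta>"
      then have "n \<in> Q" "bl_dist n m0 < r" using fs(4) by (simp_all add: tau_s_nbhd_def)
      then show "n \<in> bl.mball m0 r" using ball[OF m0] by blast
    qed
    then show "\<exists>fs y. finite fs \<and> fs \<subseteq> (bcont_fun mtopology :: ('a \<Rightarrow> 'f) set) \<and> y > 0 \<and>
        tau_s_nbhd mtopology G h m0 fs y \<subseteq> U"
      using fs(1-3) r(2) by (intro exI[of _ fs] exI[of _ \<eta>]) (auto dest: subset_trans)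
  qed
  then show ?thesis using bl.metrizable_space_mtopology by simp
qed

end

theorem theorem12:
  fixes X :: "'a topology"
    and G :: "('g, 'b) monoid_scheme"
    and h :: "'g \<Rightarrow> 'a \<Rightarrow> 'a"
  assumes "metrizable_space X"
    and "group_action G (topspace X) h"
    and "\<And>g A. g \<in> carrier G \<Longrightarrow> A \<in> zero_algebra X \<Longrightarrow> h g ` A \<in> zero_algebra X"
    and "\<And>g. g \<in> carrier G \<Longrightarrow> h g ` topspace X = topspace X"
  shows "metrizable_space (tau_s TYPE(real) X G h) \<and>
         metrizable_space (tau_s TYPE(complex) X G h)"
proof -
  obtain M d where Md: "Metric_space M d" and X: "X = Metric_space.mtopology M d"
    using assms(1) unfolding metrizable_space_def by blast
  interpret Metric_space M d by (rule Md)
  have act: "zero_algebra_action M d G h"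
    using assms(2,3) unfolding X
    by (intro zero_algebra_action.intro zero_algebra_action_axioms.intro Md) simp_all
  show ?thesis
    unfolding X by (intro conjI zero_algebra_action.metrizable_space_tau_s[OF act])
qed

end
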